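(* Let $A \subseteq \mathbb{R}^+$ with $0 \in A$. (1) If $A$ is not closed and $0$ is a limit point of $A$, then $\mathcal{V}_A$ is $\boldsymbol{\Pi}^1_1$-hard. (2) $\mathcal{V}_A$ is a Borel subset of $F(\mathbb{U})$ if and only if either $A$ is closed, or $A$ is Borel and $0$ is not a limit point of $A$. (3) If $A$ is Borel but not closed and $0$ is a limit point of $A$, then $\mathcal{V}_A$ is $\boldsymbol{\Pi}^1_1$-complete. (4) If $A$ is $\boldsymbol{\Sigma}^1_1$-complete and $0$ is a limit point of $A$, then $\mathcal{V}_A$ is $\boldsymbol{\Pi}^1_2$-complete.
   Context: $\mathbb{R}^+ = [0,\infty)$. For a metric space $X$ let $D(X) = \{ d_X(x,y) \mid x,y \in X\}$. $\mathbb{U}$ is the Urysohn space and $F(\mathbb{U})$ is the set of nonempty closed subsets of $\mathbb{U}$ with the Effros Borel structure (a standard Borel space). $\mathcal{V}_A = \{X \in F(\mathbb{U}) \mid D(X) \subseteq A\}$. For a class $\Gamma$ of sets (such as $\boldsymbol{\Sigma}^1_n$, $\boldsymbol{\Pi}^1_n$), a subset $P$ of a standard Borel space $Y$ is $\Gamma$-hard if for every standard Borel space $X$ and every $B \in \Gamma(X)$ there is a Borel $f \colon X \to Y$ with $f^{-1}(P) = B$; it is $\Gamma$-complete if moreover $P \in \Gamma(Y)$. *)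

theory Defs
  imports "HOL-Analysis.Analysis"
begin

section \<open>The Urysohn space\<close>

text \<open>
  A complete separable metric space (class \<^class>\<open>polish_space\<close>) is the Urysohn space if it is
  universal for separable metric spaces and ultrahomogeneous; this determines it up to isometry.
  A separable metric space has at most continuum many points, so requiring universality for
  metric spaces whose carrier is a set of reals is full universality.
\<close>

definition universal_metric :: "'u::polish_space itself \<Rightarrow> bool" where
  "universal_metric _ \<longleftrightarrow>
     (\<forall>(M :: real set) d.
        Metric_space M d \<and>
        (\<exists>S. countable S \<and> S \<subseteq> M \<and> Metric_space.mtopology M d closure_of S = M) \<longrightarrow>
        (\<exists>f :: real \<Rightarrow> 'u. \<forall>x\<in>M. \<forall>y\<in>M. dist (f x) (f y) = d x y))"

definition ultrahomogeneous :: "'u::polish_space itself \<Rightarrow> bool" where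
  "ultrahomogeneous _ \<longleftrightarrow>
     (\<forall>(F :: 'u set) f :: 'u \<Rightarrow> 'u.
        finite F \<and> (\<forall>x\<in>F. \<forall>y\<in>F. dist (f x) (f y) = dist x y) \<longrightarrow>
        (\<exists>g :: 'u \<Rightarrow> 'u. bij g \<and> (\<forall>x y. dist (g x) (g y) = dist x y) \<and> (\<forall>x\<in>F. g x = f x)))"

definition urysohn_space :: "'u::polish_space itself \<Rightarrow> bool" where
  "urysohn_space u \<longleftrightarrow> universal_metric u \<and> ultrahomogeneous u"


section \<open>The Effros Borel space and the sets of spaces with distances in a given set\<close>

definition nonempty_closed :: "'u::topological_space set set" where
  "nonempty_closed = {X. closed X \<and> X \<noteq> {}}"

definition effros :: "'u::topological_space set measure" where
  "effros = sigma nonempty_closed {{X \<in> nonempty_closed. X \<inter> W \<noteq> {}} | W. open W}"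

definition distances :: "'u::metric_space set \<Rightarrow> real set" where
  "distances X = {dist x y | x y. x \<in> X \<and> y \<in> X}"

definition \<V> :: "real set \<Rightarrow> 'u::metric_space set set" where
  "\<V> A = {X \<in> nonempty_closed. distances X \<subseteq> A}"


section \<open>Standard Borel spaces and projective classes\<close>

text \<open>
  Borel spaces are represented by values of type \<open>'x measure\<close>; only the carrier and the
  sigma-algebra are used, never the measure itself.
\<close>

definition standard_borel :: "'x measure \<Rightarrow> bool" where
  "standard_borel M \<longleftrightarrow>
     (\<exists>T. completely_metrizable_space T \<and>
          (\<exists>S. countable S \<and> S \<subseteq> topspace T \<and> T closure_of S = topspace T) \<and>
          topspace T = space M \<and>
          sets M = sigma_sets (space M) {W. openin T W})"

text \<open>
  The type \<open>nat \<Rightarrow> nat\<close> carries the product of the discrete topologies, so \<open>borel\<close> below is the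
  Borel space of the Baire space.  The classes are meant for standard Borel arguments.
\<close>

definition sigma11 :: "'x measure \<Rightarrow> 'x set set" where
  "sigma11 M = {fst ` C | C. C \<in> sets (M \<Otimes>\<^sub>M (borel :: (nat \<Rightarrow> nat) measure))}"

definition pi11 :: "'x measure \<Rightarrow> 'x set set" where
  "pi11 M = {space M - B | B. B \<in> sigma11 M}"

definition sigma12 :: "'x measure \<Rightarrow> 'x set set" where
  "sigma12 M = {fst ` C | C. C \<in> pi11 (M \<Otimes>\<^sub>M (borel :: (nat \<Rightarrow> nat) measure))}"

definition pi12 :: "'x measure \<Rightarrow> 'x set set" where
  "pi12 M = {space M - B | B. B \<in> sigma12 M}"

text \<open>
  A definition cannot quantify over types, so the test spaces \<open>X\<close> range over the standard Borel
  spaces on subsets of a type \<open>'x\<close>.  A statement with \<open>'x\<close> a free type variable thus covers all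
  standard Borel spaces.  Taking \<open>'x = nat \<Rightarrow> nat\<close> also loses nothing, since every standard Borel
  space is Borel isomorphic to one on a subset of the Baire space.
  A class of sets enters \<open>gamma_complete\<close> as two instances of one and the same
  polymorphic class, for the test spaces and for the ambient space \<open>Y\<close>.
\<close>

definition gamma_hard :: "('x measure \<Rightarrow> 'x set set) \<Rightarrow> 'y measure \<Rightarrow> 'y set \<Rightarrow> bool" where
  "gamma_hard \<Gamma> Y P \<longleftrightarrow>
     (\<forall>X. standard_borel X \<longrightarrow> (\<forall>B\<in>\<Gamma> X. \<exists>f \<in> X \<rightarrow>\<^sub>M Y. f -` P \<inter> space X = B))"

definition gamma_complete ::
    "('x measure \<Rightarrow> 'x set set) \<Rightarrow> ('y measure \<Rightarrow> 'y set set) \<Rightarrow> 'y measure \<Rightarrow> 'y set \<Rightarrow> bool" where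
  "gamma_complete \<Gamma> \<Gamma>' Y P \<longleftrightarrow> P \<in> \<Gamma>' Y \<and> gamma_hard \<Gamma> Y P"

end

theory Submission
  imports Defs
begin

text \<open>
  An analytic set is given by a Borel Souslin scheme, so reducing to \<open>\<V> A\<close> means turning a tree
  \<open>T\<^sub>x\<close> that depends on \<open>x\<close> in a Borel way into a closed set of points of the Urysohn space. The
  nodes above a common root carry an ultrametric with values in a sequence of \<open>A\<close> tending to \<open>0\<close>, and
  one further point sees each node at a distance in \<open>A\<close> attached to the node; nodes with nothing in
  common are at the larger of their distances from that point. Such a space of nodes has all its
  distances in \<open>A\<close>, and taking the closure adds exactly the branches, whose distances from the extra
  point are the limits along the branch. Hence the closure fails to be in \<open>\<V> A\<close> iff some branch
  has a limit outside \<open>A\<close>. With a fixed limit \<open>r \<in> closure A - A\<close> this reduces \<open>\<Pi>\<^sup>1\<^sub>1\<close> sets, and when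
  the limits are the values of a Borel function into \<open>closure A\<close> that reduces a \<open>\<Sigma>\<^sup>1\<^sub>1\<close> set to \<open>A\<close>,
  it reduces \<open>\<Pi>\<^sup>1\<^sub>2\<close> sets.
\<close>


section \<open>Souslin schemes\<close>

abbreviation baire :: "(nat \<Rightarrow> nat) measure" where
  "baire \<equiv> borel"

text \<open>Only initial segments of equal length of the point \<open>z\<close> and of the witness
  \<open>w\<close> enter, so for fixed \<open>x\<close> the section of \<open>C\<close> is the
  projection of the branches of a tree. That tree, closed under initial segments, is formed in
  \<open>effros_reduction\<close>.\<close>

definition souslin_scheme ::
    "'x measure \<Rightarrow> (nat list \<Rightarrow> nat list \<Rightarrow> 'x set) \<Rightarrow> ('x \<times> (nat \<Rightarrow> nat)) set \<Rightarrow> bool" where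
  "souslin_scheme X R C \<longleftrightarrow> (\<forall>s t. R s t \<in> sets X) \<and>
     (\<forall>x z. (x, z) \<in> C \<longleftrightarrow>
       x \<in> space X \<and> (\<exists>w. \<forall>n. x \<in> R (map z [0..<n]) (map w [0..<n])))"

definition souslin :: "'x measure \<Rightarrow> ('x \<times> (nat \<Rightarrow> nat)) set \<Rightarrow> bool" where
  "souslin X C \<longleftrightarrow> (\<exists>R. souslin_scheme X R C)"

text \<open>The first entry of the witness names the index \<open>i\<close> and the rest is a
  witness for \<open>C i\<close>. As this shifts the witness by one, the segment of \<open>z\<close>
  is cut by one entry to keep the lengths equal.\<close>

lemma souslin_UN:
  fixes X :: "'x measure"
  assumes "\<And>i :: nat. souslin X (C i)"
  shows "souslin X (\<Union>i. C i)"
proof -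
  obtain R where R': "\<And>i. souslin_scheme X (R i) (C i)"
    using assms unfolding souslin_def by metis
  have R: "\<And>i s t. R i s t \<in> sets X"
    "\<And>i x z. (x, z) \<in> C i \<longleftrightarrow>
      x \<in> space X \<and> (\<exists>w. \<forall>n. x \<in> R i (map z [0..<n]) (map w [0..<n]))"
    using R' by (simp_all only: souslin_scheme_def)
  define S where "S s t = (case t of [] \<Rightarrow> space X | i # t' \<Rightarrow> R i (take (length t') s) t')"
    for s t
  have "souslin_scheme X S (\<Union>i. C i)"
    unfolding souslin_scheme_def
  proof (intro conjI allI)
    show "S s t \<in> sets X" for s t
      using R(1) by (auto simp: S_def split: list.split)
    fix x z
    have S_Suc: "S (map z [0..<Suc n]) (map w [0..<Suc n])
      = R (w 0) (map z [0..<n]) (map (w \<circ> Suc) [0..<n])" for w n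
    proof -
      have "map w [0..<Suc n] = w 0 # map (w \<circ> Suc) [0..<n]"
        by (simp add: upt_conv_Cons map_Suc_upt[symmetric] del: upt_Suc)
      then show ?thesis by (simp add: S_def take_map del: upt_Suc)
    qed
    have "(\<exists>w. \<forall>n. x \<in> S (map z [0..<n]) (map w [0..<n]))
      \<longleftrightarrow> (\<exists>i w. \<forall>n. x \<in> R i (map z [0..<n]) (map w [0..<n]))" if x: "x \<in> space X"
    proof
      assume "\<exists>w. \<forall>n. x \<in> S (map z [0..<n]) (map w [0..<n])"
      then obtain w where w: "\<And>n. x \<in> S (map z [0..<n]) (map w [0..<n])" by auto
      show "\<exists>i w. \<forall>n. x \<in> R i (map z [0..<n]) (map w [0..<n])"
        using w[of "Suc n" for n] unfolding S_Suc by blast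
    next
      assume "\<exists>i w. \<forall>n. x \<in> R i (map z [0..<n]) (map w [0..<n])"
      then obtain i w where w: "\<And>n. x \<in> R i (map z [0..<n]) (map w [0..<n])" by auto
      define w' where "w' = case_nat i w"
      have "w' \<circ> Suc = w" "w' 0 = i" by (auto simp: w'_def)
      then have "x \<in> S (map z [0..<n]) (map w' [0..<n])" for n
        using w x S_Suc[of _ w'] by (cases n) (auto simp: S_def simp del: upt_Suc)
      then show "\<exists>w. \<forall>n. x \<in> S (map z [0..<n]) (map w [0..<n])" by blast
    qed
    then show "(x, z) \<in> (\<Union>i. C i) \<longleftrightarrow>
      x \<in> space X \<and> (\<exists>w. \<forall>n. x \<in> S (map z [0..<n]) (map w [0..<n]))"
      by (simp add: R(2) cong: conj_cong)
  qed
  then show ?thesis unfolding souslin_def by blast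
qed

lemma souslin_INT:
  fixes X :: "'x measure"
  assumes "\<And>i :: nat. souslin X (C i)"
  shows "souslin X (\<Inter>i. C i)"
proof -
  obtain R where R': "\<And>i. souslin_scheme X (R i) (C i)"
    using assms unfolding souslin_def by metis
  have R: "\<And>i s t. R i s t \<in> sets X"
    "\<And>i x z. (x, z) \<in> C i \<longleftrightarrow>
      x \<in> space X \<and> (\<exists>w. \<forall>n. x \<in> R i (map z [0..<n]) (map w [0..<n]))"
    using R' by (simp_all only: souslin_scheme_def)
  \<comment> \<open>One sequence \<open>w\<close> codes the witnesses \<open>\<lambda>k. w (prod_encode (i, k))\<close> for all \<open>C i\<close>;
     the condition on length \<open>n\<close> of the \<open>i\<close>-th one is imposed as soon as it can be read off.\<close>
  define J where "J N = {(i, n). n \<le> N \<and> (\<forall>k<n. prod_encode (i, k) < N)}" for N :: nat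
  define S where "S s t = space X \<inter> (\<Inter>(i, n)\<in>J (min (length s) (length t)).
      R i (take n s) (map (\<lambda>k. t ! prod_encode (i, k)) [0..<n]))" for s t
  have "souslin_scheme X S (\<Inter>i. C i)"
    unfolding souslin_scheme_def
  proof (intro conjI allI)
    show "S s t \<in> sets X" for s t
    proof (cases "J (min (length s) (length t)) = {}")
      case False
      then show ?thesis
        unfolding S_def using R(1)
        by (intro sets.Int sets.countable_INT' sets.top countableI_type) auto
    qed (simp add: S_def)
    fix x z
    have S_eq: "x \<in> S (map z [0..<N]) (map w [0..<N]) \<longleftrightarrow>
        x \<in> space X \<and> (\<forall>i n. (i, n) \<in> J N \<longrightarrow>
          x \<in> R i (map z [0..<n]) (map (\<lambda>k. w (prod_encode (i, k))) [0..<n]))" for w N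
    proof -
      have eqs: "map (\<lambda>k. map w [0..<N] ! prod_encode (i, k)) [0..<n]
          = map (\<lambda>k. w (prod_encode (i, k))) [0..<n]" "take n (map z [0..<N]) = map z [0..<n]"
        if "(i, n) \<in> J N" for i n
        using that by (auto simp: J_def take_map)
      have "x \<in> S (map z [0..<N]) (map w [0..<N]) \<longleftrightarrow>
        x \<in> space X \<and> (\<forall>i n. (i, n) \<in> J N \<longrightarrow> x \<in> R i (take n (map z [0..<N]))
          (map (\<lambda>k. map w [0..<N] ! prod_encode (i, k)) [0..<n]))"
        by (auto simp: S_def)
      also have "\<dots> \<longleftrightarrow> x \<in> space X \<and> (\<forall>i n. (i, n) \<in> J N \<longrightarrow>
          x \<in> R i (map z [0..<n]) (map (\<lambda>k. w (prod_encode (i, k))) [0..<n]))"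
        by (simp add: eqs cong: imp_cong)
      finally show ?thesis .
    qed
    have "(\<exists>w. \<forall>N. x \<in> S (map z [0..<N]) (map w [0..<N]))
      \<longleftrightarrow> (\<forall>i. \<exists>w. \<forall>n. x \<in> R i (map z [0..<n]) (map w [0..<n]))" if x: "x \<in> space X"
    proof
      assume "\<exists>w. \<forall>N. x \<in> S (map z [0..<N]) (map w [0..<N])"
      then obtain w where w: "\<And>N. x \<in> S (map z [0..<N]) (map w [0..<N])" by auto
      have "x \<in> R i (map z [0..<n]) (map (\<lambda>k. w (prod_encode (i, k))) [0..<n])" for i n
      proof -
        \<comment> \<open>The sum exceeds every code \<open>prod_encode (i, k)\<close> with
          \<open>k < n\<close>, so at this length all the required entries of \<open>w\<close> have
          appeared.\<close>
        have "(i, n) \<in> J (n + (\<Sum>k<n. Suc (prod_encode (i, k))))"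
        proof -
          have "prod_encode (i, k) < n + (\<Sum>k<n. Suc (prod_encode (i, k)))" if "k < n" for k
            using member_le_sum[of k "{..<n}" "\<lambda>k. Suc (prod_encode (i, k))"] that by auto
          then show ?thesis by (auto simp: J_def)
        qed
        then show ?thesis using w S_eq by blast
      qed
      then show "\<forall>i. \<exists>w. \<forall>n. x \<in> R i (map z [0..<n]) (map w [0..<n])" by blast
    next
      assume "\<forall>i. \<exists>w. \<forall>n. x \<in> R i (map z [0..<n]) (map w [0..<n])"
      then obtain w where w: "\<And>i n. x \<in> R i (map z [0..<n]) (map (w i) [0..<n])" by metis
      define w' where "w' m = (case prod_decode m of (i, k) \<Rightarrow> w i k)" for m
      have "x \<in> S (map z [0..<N]) (map w' [0..<N])" for N
        using w x by (simp add: S_eq w'_def)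
      then show "\<exists>w. \<forall>n. x \<in> S (map z [0..<n]) (map w [0..<n])" by blast
    qed
    then show "(x, z) \<in> (\<Inter>i. C i) \<longleftrightarrow>
      x \<in> space X \<and> (\<exists>w. \<forall>n. x \<in> S (map z [0..<n]) (map w [0..<n]))"
      by (simp add: R(2) cong: conj_cong)
  qed
  then show ?thesis unfolding souslin_def by blast
qed

text \<open>A countable product of second countable spaces has the product sigma-algebra as its
  Borel sets, so measurability is checked on coordinates, and every subset of \<open>nat\<close> is
  Borel.\<close>

lemma measurable_baire_iff:
  "f \<in> X \<rightarrow>\<^sub>M baire \<longleftrightarrow> (\<forall>i. (\<lambda>x. f x i) \<in> X \<rightarrow>\<^sub>M count_space UNIV)"
proof -
  have "sets (Pi\<^sub>M UNIV (\<lambda>_. count_space UNIV :: nat measure)) = sets baire"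
    unfolding sets_PiM_equal_borel[symmetric]
    by (rule sets_PiM_cong) (auto simp: sets_borel_eq_count_space)
  then have "f \<in> X \<rightarrow>\<^sub>M baire
      \<longleftrightarrow> f \<in> X \<rightarrow>\<^sub>M (Pi\<^sub>M UNIV (\<lambda>_. count_space UNIV :: nat measure))"
    using measurable_cong_sets by blast
  also have "\<dots> \<longleftrightarrow> (\<forall>i. (\<lambda>x. f x i) \<in> X \<rightarrow>\<^sub>M count_space UNIV)"
    by (auto intro!: measurable_PiM_single' dest: measurable_component_singleton[THEN measurable_compose[rotated]])
  finally show ?thesis .
qed

text \<open>The sets that are Souslin together with their complement form a sigma-algebra, by
  \<open>souslin_UN\<close> and \<open>souslin_INT\<close>. Both projections are measurable for it,
  hence it contains the product sigma-algebra.\<close>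

lemma sets_pair_baire_souslin:
  assumes C: "C \<in> sets (X \<Otimes>\<^sub>M baire)"
  shows "souslin X C"
proof -
  define \<Omega> where "\<Omega> = space X \<times> (UNIV :: (nat \<Rightarrow> nat) set)"
  define K where "K = {C. C \<subseteq> \<Omega> \<and> souslin X C \<and> souslin X (\<Omega> - C)}"
  \<comment> \<open>A condition on the single entry \<open>z k\<close> is decided once the segment
    \<open>s\<close> is longer than \<open>k\<close>; shorter segments impose nothing.\<close>
  have level: "souslin X {(x, z). x \<in> space X \<and> P z}"
    if P: "\<And>z. P z \<longleftrightarrow> Q (z k)" for k P Q
    unfolding souslin_def souslin_scheme_def using P
    by (intro exI[of _ "\<lambda>s t. if k < length s \<and> \<not> Q (s ! k) then {} else space X"])
       (auto dest: spec[of _ "Suc k"] split: if_splits simp del: upt_Suc)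
  have sigma: "sigma_algebra \<Omega> K"
  proof (rule sigma_algebra_iff2[THEN iffD2], intro conjI ballI allI impI)
    show "K \<subseteq> Pow \<Omega>" by (auto simp: K_def)
    have "{(x, z). x \<in> space X \<and> False} = {}" "{(x, z). x \<in> space X \<and> True} = \<Omega>"
      by (auto simp: \<Omega>_def)
    then have "souslin X {}" "souslin X \<Omega>"
      using level[of "\<lambda>_. False" "\<lambda>_. False" 0] level[of "\<lambda>_. True" "\<lambda>_. True" 0] by simp_all
    then show "{} \<in> K" by (auto simp: K_def)
    show "\<Omega> - s \<in> K" if "s \<in> K" for s using that by (auto simp: K_def double_diff)
    fix F :: "nat \<Rightarrow> _" assume "range F \<subseteq> K"
    then have F: "F i \<in> K" for i by auto
    have "\<Omega> - (\<Union>i. F i) = (\<Inter>i. \<Omega> - F i)" by auto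
    moreover have "souslin X (\<Union>i. F i)" "souslin X (\<Inter>i. \<Omega> - F i)"
      using F by (intro souslin_UN souslin_INT; simp add: K_def)+
    moreover have "(\<Union>i. F i) \<subseteq> \<Omega>" using F by (auto simp: K_def)
    ultimately show "(\<Union>i. F i) \<in> K" by (simp add: K_def)
  qed
  define N where "N = sigma \<Omega> K"
  have sets_N: "sets N = K" and space_N: "space N = \<Omega>"
    using sigma by (auto simp: N_def sigma_algebra.sets_measure_of_eq sigma_algebra.space_measure_of_eq)
  have "fst \<in> N \<rightarrow>\<^sub>M X"
  proof (rule measurableI)
    fix A assume A: "A \<in> sets X"
    have "souslin X (B \<times> UNIV)" if "B \<in> sets X" for B
      unfolding souslin_def souslin_scheme_def
      using that sets.sets_into_space[OF that] by (intro exI[of _ "\<lambda>_ _. B"]) auto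
    from this[OF A] this[of "space X - A"] A
    have "souslin X (A \<times> UNIV)" "souslin X (\<Omega> - A \<times> UNIV)"
      by (auto simp: \<Omega>_def Sigma_Diff_distrib1)
    then have "A \<times> UNIV \<in> K"
      using sets.sets_into_space[OF A] by (auto simp: K_def \<Omega>_def)
    moreover have "fst -` A \<inter> space N = A \<times> UNIV"
      using sets.sets_into_space[OF A] by (auto simp: space_N \<Omega>_def)
    ultimately show "fst -` A \<inter> space N \<in> sets N" by (simp add: sets_N)
  qed (auto simp: space_N \<Omega>_def)
  moreover have "snd \<in> N \<rightarrow>\<^sub>M baire"
    unfolding measurable_baire_iff
  proof (intro allI measurableI)
    fix i :: nat and A :: "nat set"
    have "(\<lambda>x. snd x i) -` A \<inter> space N = {(x, z). x \<in> space X \<and> z i \<in> A}"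
      "\<Omega> - {(x, z). x \<in> space X \<and> z i \<in> A} = {(x, z). x \<in> space X \<and> z i \<notin> A}"
      by (auto simp: space_N \<Omega>_def)
    then show "(\<lambda>x. snd x i) -` A \<inter> space N \<in> sets N"
      using level[of "\<lambda>z. z i \<in> A" "\<lambda>m. m \<in> A" i] level[of "\<lambda>z. z i \<notin> A" "\<lambda>m. m \<notin> A" i]
      by (auto simp: sets_N K_def \<Omega>_def)
  qed simp
  \<comment> \<open>This map is the identity on \<open>\<Omega>\<close>, so its measurability puts
    every set of the product sigma-algebra into \<open>K\<close>.\<close>
  ultimately have "(\<lambda>p. (fst p, snd p)) \<in> N \<rightarrow>\<^sub>M X \<Otimes>\<^sub>M borel" by (rule measurable_Pair)
  from measurable_sets[OF this C] sets.sets_into_space[OF C] have "C \<in> K"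
    by (auto simp: sets_N space_N \<Omega>_def space_pair_measure Int_absorb2)
  then show ?thesis by (simp add: K_def)
qed

section \<open>Pairing in the Baire space and codes of Souslin schemes\<close>

lemma measurable_baire_component [measurable (raw)]:
  "f \<in> X \<rightarrow>\<^sub>M baire \<Longrightarrow> (\<lambda>x. f x i) \<in> X \<rightarrow>\<^sub>M count_space UNIV"
  by (simp add: measurable_baire_iff)

text \<open>Pairing is coordinatewise, not by interleaving, so the \<open>k\<close>-th entry of a
  sequence already determines the \<open>k\<close>-th entries of both halves; the node values in
  \<open>effros_reduction\<close> rely on this.\<close>

definition join :: "(nat \<Rightarrow> nat) \<Rightarrow> (nat \<Rightarrow> nat) \<Rightarrow> nat \<Rightarrow> nat" where
  "join z w = (\<lambda>n. prod_encode (z n, w n))"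

definition left :: "(nat \<Rightarrow> nat) \<Rightarrow> nat \<Rightarrow> nat" where
  "left u = (\<lambda>n. fst (prod_decode (u n)))"

definition right :: "(nat \<Rightarrow> nat) \<Rightarrow> nat \<Rightarrow> nat" where
  "right u = (\<lambda>n. snd (prod_decode (u n)))"

lemma left_join [simp]: "left (join z w) = z" and right_join [simp]: "right (join z w) = w"
  by (simp_all add: left_def right_def join_def)

lemma measurable_left [measurable]: "left \<in> baire \<rightarrow>\<^sub>M baire"
  and measurable_right [measurable]: "right \<in> baire \<rightarrow>\<^sub>M baire"
  unfolding measurable_baire_iff left_def right_def by measurable

text \<open>The position at which \<open>a x\<close> is evaluated varies with \<open>x\<close>.
  Ranging over all fixed pairs of lists instead gives a countable conjunction of Borel
  conditions.\<close>

lemma pred_souslin_code: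
  assumes [measurable]: "a \<in> X \<rightarrow>\<^sub>M baire"
    "z \<in> X \<rightarrow>\<^sub>M baire" "w \<in> X \<rightarrow>\<^sub>M baire"
  shows "Measurable.pred X
    (\<lambda>x. \<forall>n. a x (to_nat (map (z x) [0..<n], map (w x) [0..<n])) = (1 :: nat))"
proof -
  have "(\<forall>n. a x (to_nat (map (z x) [0..<n], map (w x) [0..<n])) = 1) \<longleftrightarrow>
    (\<forall>s t. length s = length t \<longrightarrow> (\<forall>i<length s. z x i = s ! i \<and> w x i = t ! i) \<longrightarrow>
      a x (to_nat (s, t)) = 1)" (is "?l \<longleftrightarrow> ?r") for x
  proof
    assume ?l
    show ?r
    proof (intro allI impI)
      fix s t assume *: "length s = length t" "\<forall>i<length s. z x i = s ! i \<and> w x i = t ! i"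
      have "map (z x) [0..<length s] = s" "map (w x) [0..<length s] = t"
        by (rule nth_equalityI; use * in simp)+
      with \<open>?l\<close> show "a x (to_nat (s, t)) = 1" by metis
    qed
  qed simp
  then show ?thesis by simp
qed

text \<open>A point \<open>a\<close> is read as the set of pairs of lists on which it takes the
  value 1. The codes collected are those with an infinite branch, the counterpart of ill-founded
  trees; this is the complete analytic set used throughout.\<close>

definition souslin_codes :: "(nat \<Rightarrow> nat) set" where
  "souslin_codes = {a. \<exists>(z :: nat \<Rightarrow> nat) (w :: nat \<Rightarrow> nat). \<forall>n. a (to_nat (map z [0..<n], map w [0..<n])) = (1 :: nat)}"

text \<open>The two witnesses are packed by \<open>join\<close> into the single Baire coordinate
  that is projected away.\<close>

lemma souslin_codes_sigma11: "souslin_codes \<in> sigma11 borel"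
proof -
  let ?C = "{p \<in> space (baire \<Otimes>\<^sub>M baire). \<forall>n. fst p (to_nat
    (map (left (snd p)) [0..<n], map (right (snd p)) [0..<n])) = (1 :: nat)}"
  have "?C \<in> sets (baire \<Otimes>\<^sub>M baire)"
    by (rule pred_souslin_code[unfolded pred_def]) measurable
  moreover have "souslin_codes = fst ` ?C"
  proof (intro equalityI subsetI)
    fix a assume "a \<in> souslin_codes"
    then obtain z w :: "nat \<Rightarrow> nat" where "\<forall>n. a (to_nat (map z [0..<n], map w [0..<n])) = 1"
      by (auto simp: souslin_codes_def)
    then show "a \<in> fst ` ?C"
      by (intro image_eqI[of _ _ "(a, join z w)"]) (simp_all add: space_pair_measure)
  qed (auto simp: souslin_codes_def)
  ultimately show ?thesis unfolding sigma11_def by blast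
qed

text \<open>The code of \<open>x\<close> is the indicator of the pairs \<open>(s, t)\<close> with
  \<open>x \<in> R s t\<close>. Projecting \<open>C\<close> quantifies \<open>z\<close>
  existentially next to \<open>w\<close>, which is exactly a branch of that code.\<close>

lemma sigma11_reduces_souslin_codes:
  assumes "S \<in> sigma11 X"
  obtains f where "f \<in> X \<rightarrow>\<^sub>M borel" "\<And>x. x \<in> space X \<Longrightarrow> x \<in> S \<longleftrightarrow> f x \<in> souslin_codes"
proof -
  obtain C where C: "C \<in> sets (X \<Otimes>\<^sub>M baire)" "S = fst ` C"
    using assms unfolding sigma11_def by auto
  obtain R where R: "souslin_scheme X R C"
    using sets_pair_baire_souslin[OF C(1)] unfolding souslin_def by auto
  then have [measurable]: "R s t \<in> sets X" for s t by (simp add: souslin_scheme_def)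
  define f where "f x m = (if x \<in> case_prod R (from_nat m) then 1 else 0 :: nat)" for x m
  show thesis
  proof
    show "f \<in> X \<rightarrow>\<^sub>M borel"
      unfolding measurable_baire_iff f_def case_prod_beta by measurable
    fix x assume "x \<in> space X"
    then show "x \<in> S \<longleftrightarrow> f x \<in> souslin_codes"
      using R unfolding C(2) souslin_scheme_def
      by (force simp: souslin_codes_def f_def split: if_splits)
  qed
qed

text \<open>Cantor's diagonal argument: a point of the Baire space is read as a Souslin scheme.\<close>

lemma souslin_codes_not_borel: "souslin_codes \<notin> sets borel"
proof
  assume Q: "souslin_codes \<in> sets borel"
  \<comment> \<open>Here \<open>z\<close> serves both as the code of a scheme and as the point
    tested against it. \<open>U\<close> is analytic, hence Borel under the assumption on
    \<open>souslin_codes\<close>.\<close>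
  define U where "U = {z. \<exists>w :: nat \<Rightarrow> nat. \<forall>n. z (to_nat (map z [0..<n], map w [0..<n])) = (1 :: nat)}"
  let ?C = "{p \<in> space (baire \<Otimes>\<^sub>M baire). \<forall>n. fst p (to_nat
    (map (fst p) [0..<n], map (snd p) [0..<n])) = (1 :: nat)}"
  have "?C \<in> sets (baire \<Otimes>\<^sub>M baire)"
    by (rule pred_souslin_code[unfolded pred_def]) measurable
  moreover have "U = fst ` ?C"
  proof (intro equalityI subsetI)
    fix z assume "z \<in> U"
    then obtain w :: "nat \<Rightarrow> nat" where "\<forall>n. z (to_nat (map z [0..<n], map w [0..<n])) = 1"
      by (auto simp: U_def)
    then show "z \<in> fst ` ?C"
      by (intro image_eqI[of _ _ "(z, w)"]) (simp_all add: space_pair_measure)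
  qed (auto simp: U_def)
  ultimately have "U \<in> sigma11 borel" unfolding sigma11_def by blast
  then obtain f where f: "f \<in> baire \<rightarrow>\<^sub>M baire" "\<And>x. x \<in> U \<longleftrightarrow> f x \<in> souslin_codes"
    using sigma11_reduces_souslin_codes[of U borel] by auto
  have "U = f -` souslin_codes \<inter> space borel" using f(2) by auto
  with f(1) Q have "U \<in> sets borel" by (simp only: measurable_sets)
  \<comment> \<open>A one-point first factor turns the complement of \<open>U\<close> into a set
    whose scheme carries no further parameter and so can be coded by one point.\<close>
  then have "UNIV \<times> - U \<in> sets (count_space (UNIV :: unit set) \<Otimes>\<^sub>M borel)"
    by (intro pair_measureI) auto
  from sets_pair_baire_souslin[OF this] obtain R :: "nat list \<Rightarrow> nat list \<Rightarrow> unit set"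
    where R: "z \<notin> U \<longleftrightarrow> (\<exists>w. \<forall>n. () \<in> R (map z [0..<n]) (map w [0..<n]))" for z
    unfolding souslin_def souslin_scheme_def by auto
  \<comment> \<open>The code of the scheme of \<open>- U\<close>: it belongs to \<open>U\<close> iff
    it belongs to \<open>- U\<close>.\<close>
  define z where "z m = (if () \<in> case_prod R (from_nat m) then 1 else 0 :: nat)" for m
  have "z \<in> U \<longleftrightarrow> (\<exists>w. \<forall>n. () \<in> R (map z [0..<n]) (map w [0..<n]))"
    unfolding U_def by (simp add: z_def)
  with R[of z] show False by blast
qed

lemma standard_borel_baire: "standard_borel baire"
  unfolding standard_borel_def
proof (intro exI[of _ euclidean] conjI)
  have discrete: "euclidean = discrete_topology (UNIV :: nat set)"
    by (rule topology_eq[THEN iffD2]) (simp add: open_discrete)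
  show "completely_metrizable_space (euclidean :: (nat \<Rightarrow> nat) topology)"
    by (simp add: euclidean_product_topology[symmetric] completely_metrizable_space_product_topology
        discrete completely_metrizable_space_discrete_topology)
  obtain S :: "(nat \<Rightarrow> nat) set" where "countable S" "closure S = UNIV"
  proof -
    obtain S :: "(nat \<Rightarrow> nat) set" where S: "countable S" "\<And>W. open W \<Longrightarrow> W \<noteq> {} \<Longrightarrow> \<exists>d\<in>S. d \<in> W"
      by (rule countable_dense_setE) blast
    from S(2)[of "- closure S"] have "closure S = UNIV"
      using closure_subset[of S] by auto
    with S(1) show thesis by (rule that)
  qed
  then show "\<exists>S. countable S \<and> S \<subseteq> topspace euclidean \<and>
      euclidean closure_of S = topspace (euclidean :: (nat \<Rightarrow> nat) topology)"
    by auto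
qed (auto simp: borel_def)


section \<open>A metric on the nodes of a tree\<close>

text \<open>Universality speaks of metrics on sets of reals, so the metric is carried over to
  natural numbers inside the reals. A countable space is its own countable dense subset.\<close>

lemma universal_metric_countable:
  fixes N :: "'n set"
  assumes U: "universal_metric TYPE('u::polish_space)"
    and d: "Metric_space N d" and N: "countable N"
  obtains e :: "'n \<Rightarrow> 'u::polish_space" where "\<And>x y. x \<in> N \<Longrightarrow> y \<in> N \<Longrightarrow> dist (e x) (e y) = d x y"
proof -
  interpret d: Metric_space N d by (rule d)
  define g where "g x = real (to_nat_on N x)" for x
  have g: "inj_on g N"
    using inj_on_to_nat_on[OF N] by (auto simp: g_def inj_on_def)
  let ?h = "inv_into N g"
  \<comment> \<open>The default 0 is there because nonnegativity and symmetry of a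
    \<open>Metric_space\<close> are required off the carrier too.\<close>
  define d' where "d' r s = (if r \<in> g ` N \<and> s \<in> g ` N then d (?h r) (?h s) else 0)" for r s
  have d': "d' (g x) (g y) = d x y" if "x \<in> N" "y \<in> N" for x y
    using that g by (simp add: d'_def)
  interpret d': Metric_space "g ` N" d'
  proof
    show "0 \<le> d' x y" "d' x y = d' y x" for x y by (simp_all add: d'_def d.commute)
    show "d' x y = 0 \<longleftrightarrow> x = y" if "x \<in> g ` N" "y \<in> g ` N" for x y
      using that g by (auto simp: d' inj_on_eq_iff)
    show "d' x z \<le> d' x y + d' y z" if "x \<in> g ` N" "y \<in> g ` N" "z \<in> g ` N" for x y z
      using that by (auto simp: d' d.triangle)
  qed
  have sep: "\<exists>S. countable S \<and> S \<subseteq> g ` N \<and> d'.mtopology closure_of S = g ` N"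
    using N closure_of_topspace[of d'.mtopology] by (intro exI[of _ "g ` N"]) auto
  obtain f :: "real \<Rightarrow> 'u" where f: "\<forall>x\<in>g ` N. \<forall>y\<in>g ` N. dist (f x) (f y) = d' x y"
    using U[unfolded universal_metric_def, rule_format, OF conjI, OF d'.Metric_space_axioms sep] ..
  show thesis
    by (rule that[of "f \<circ> g"]) (use f d' in auto)
qed

section \<open>Longest common prefixes\<close>

fun lcp :: "'a list \<Rightarrow> 'a list \<Rightarrow> nat" where
  "lcp (x # xs) (y # ys) = (if x = y then Suc (lcp xs ys) else 0)"
| "lcp _ _ = 0"

lemma le_lcp_iff: "k \<le> lcp s t \<longleftrightarrow> k \<le> length s \<and> k \<le> length t \<and> take k s = take k t"
proof (induction s t arbitrary: k rule: lcp.induct)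
  case (1 x xs y ys)
  then show ?case by (cases k) auto
qed auto

lemma lcp_commute: "lcp s t = lcp t s"
  by (induction s t rule: lcp.induct) auto

lemma lcp_ultrametric: "min (lcp s t) (lcp t u) \<le> lcp s u"
proof -
  let ?k = "min (lcp s t) (lcp t u)"
  have "?k \<le> lcp s t" "?k \<le> lcp t u" by auto
  then show ?thesis unfolding le_lcp_iff by simp
qed

lemma lcp_take: "k \<le> length t \<Longrightarrow> lcp (take k t) t = k"
  using le_lcp_iff[of k "take k t" t] le_lcp_iff[of "lcp (take k t) t" "take k t" t]
  by (simp add: le_antisym)

text \<open>The numbers \<open>a n\<close> become the distances inside one cone of nodes, the
  numbers \<open>val l\<close> the distances from the centre; in the application both lie in
  \<open>A\<close>.\<close>

locale tree_metric =
  fixes a :: "nat \<Rightarrow> real" and val :: "'l \<Rightarrow> real"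
  assumes a_pos: "0 < a n" and a_decseq: "decseq a" and a_lim: "a \<longlonglongrightarrow> 0"
    and val_pos: "0 < val l"
begin

text \<open>
  A node \<open>(m, s)\<close> with \<open>s \<noteq> []\<close> approximates the limit of \<open>val\<close> along a branch through \<open>s\<close>; the
  scale \<open>m\<close> keeps \<open>a m\<close> below that limit. The point \<open>(0, [])\<close> is the centre, from which the
  distance to a node is its value \<open>rho\<close>.
\<close>

definition nodes :: "(nat \<times> 'l list) set" where
  "nodes = {(m, s). (s = [] \<longrightarrow> m = 0) \<and>
     (\<forall>i j. i \<le> j \<longrightarrow> j < length s \<longrightarrow>
       \<bar>val (s ! i) - val (s ! j)\<bar> \<le> a (m + Suc i) / 2 \<and> a m \<le> val (s ! j))}"

definition rho :: "nat \<times> 'l list \<Rightarrow> real" where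
  "rho x = (if snd x = [] then 0 else val (last (snd x)))"

definition near :: "nat \<times> 'l list \<Rightarrow> nat \<times> 'l list \<Rightarrow> bool" where
  "near x y \<longleftrightarrow> fst x = fst y \<and> 0 < lcp (snd x) (snd y)"

text \<open>Adding the scale to the index keeps distances between near nodes at most
  \<open>a (m + 1)\<close>, hence below the values of the nodes of scale \<open>m\<close>. The
  centre is near no node, so its distance to \<open>x\<close> comes out as
  \<open>rho x\<close>.\<close>

definition nd :: "nat \<times> 'l list \<Rightarrow> nat \<times> 'l list \<Rightarrow> real" where
  "nd x y = (if x = y then 0 else if near x y then a (fst x + lcp (snd x) (snd y))
     else max (rho x) (rho y))"

lemma a_antimono: "m \<le> n \<Longrightarrow> a n \<le> a m"
  using a_decseq by (simp add: decseq_def)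

lemma rho_nonneg: "0 \<le> rho x"
  using val_pos by (simp add: rho_def less_imp_le)

lemma near_commute: "near x y \<longleftrightarrow> near y x"
  by (auto simp: near_def lcp_commute)

lemma near_trans: "near x y \<Longrightarrow> near y z \<Longrightarrow> near x z"
  using lcp_ultrametric[of "snd x" "snd y" "snd z"] by (auto simp: near_def)

lemma nd_commute: "nd x y = nd y x"
  by (auto simp: nd_def near_commute lcp_commute max.commute) (auto simp: near_def)

lemma nd_nonneg: "0 \<le> nd x y"
  using a_pos rho_nonneg by (auto simp: nd_def less_imp_le le_max_iff_disj)

text \<open>The node condition is applied to the last common label, at index \<open>lcp - 1\<close>,
  and the last label of \<open>x\<close>. The half in the bound pays for the two sides in
  \<open>near_rho_diff\<close>.\<close>

lemma near_rho:
  assumes x: "x \<in> nodes" and xy: "near x y"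
  shows "\<bar>val (snd x ! (lcp (snd x) (snd y) - 1)) - rho x\<bar> \<le> a (fst x + lcp (snd x) (snd y)) / 2"
    and "a (fst x + lcp (snd x) (snd y)) \<le> rho x"
proof -
  obtain m s where xs: "x = (m, s)" by force
  obtain n t where ys: "y = (n, t)" by force
  let ?k = "lcp s t"
  have k: "0 < ?k" "?k \<le> length s" using xy le_lcp_iff[of ?k s t] by (auto simp: xs ys near_def)
  then have "s \<noteq> []" by auto
  then have rho: "rho (m, s) = val (s ! (length s - 1))" by (simp add: rho_def last_conv_nth)
  have *: "\<bar>val (s ! i) - val (s ! j)\<bar> \<le> a (m + Suc i) / 2 \<and> a m \<le> val (s ! j)"
    if "i \<le> j" "j < length s" for i j
    using x that by (auto simp: xs nodes_def)
  have "\<bar>val (s ! (?k - 1)) - val (s ! (length s - 1))\<bar> \<le> a (m + Suc (?k - 1)) / 2 \<and>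
      a m \<le> val (s ! (length s - 1))"
    by (rule *) (use k in auto)
  with k a_antimono[of m "m + ?k"]
  show "\<bar>val (snd x ! (lcp (snd x) (snd y) - 1)) - rho x\<bar> \<le> a (fst x + lcp (snd x) (snd y)) / 2"
    and "a (fst x + lcp (snd x) (snd y)) \<le> rho x"
    by (simp_all add: rho xs ys)
qed

text \<open>Both values are compared with that of the last common label. So \<open>rho\<close>
  changes by at most the distance between near nodes, which the mixed cases of the triangle
  inequality need.\<close>

lemma near_rho_diff:
  assumes x: "x \<in> nodes" and y: "y \<in> nodes" and xy: "near x y"
  shows "\<bar>rho x - rho y\<bar> \<le> a (fst x + lcp (snd x) (snd y))"
proof -
  let ?k = "lcp (snd x) (snd y)"
  have "take ?k (snd x) = take ?k (snd y)" "0 < ?k" "fst x = fst y"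
    using xy le_lcp_iff[of ?k "snd x" "snd y"] by (auto simp: near_def)
  moreover from this have "snd x ! (?k - 1) = snd y ! (?k - 1)"
    by (metis diff_less nth_take zero_less_one)
  moreover have "near y x" "lcp (snd y) (snd x) = ?k"
    using xy near_commute lcp_commute by blast+
  moreover from this have "\<bar>val (snd y ! (?k - 1)) - rho y\<bar> \<le> a (fst y + ?k) / 2"
    using near_rho(1)[OF y, of x] by simp
  moreover have "\<bar>val (snd x ! (?k - 1)) - rho x\<bar> \<le> a (fst x + ?k) / 2"
    by (rule near_rho(1)[OF x xy])
  moreover have "\<bar>p - q\<bar> \<le> b" if "\<bar>c - p\<bar> \<le> b / 2" "\<bar>c - q\<bar> \<le> b / 2" for b c p q :: real
    using that by linarith
  ultimately show ?thesis by metis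
qed

text \<open>If all three are near, \<open>lcp_ultrametric\<close> applies. If only \<open>x\<close>
  and \<open>y\<close>, or only \<open>y\<close> and \<open>z\<close>, are near, replacing one by
  the other changes \<open>rho\<close> by at most their distance. If only \<open>x\<close> and
  \<open>z\<close> are near, their distance is below \<open>rho x\<close>. Otherwise all distances
  are maxima of values.\<close>

lemma nd_triangle:
  assumes x: "x \<in> nodes" and y: "y \<in> nodes" and z: "z \<in> nodes"
  shows "nd x z \<le> nd x y + nd y z"
proof (cases "x = y \<or> y = z \<or> x = z")
  case True
  moreover have "nd x x = 0" "nd y y = 0" by (simp_all add: nd_def)
  ultimately show ?thesis using nd_nonneg[of x y] nd_nonneg[of y z] by (elim disjE) simp_all
next
  case False
  then have ne: "x \<noteq> y" "y \<noteq> z" "x \<noteq> z" by auto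
  let ?k = "\<lambda>x y. lcp (snd x) (snd y)"
  note r = rho_nonneg[of x] rho_nonneg[of y] rho_nonneg[of z]
  consider "near x y" "near y z" | "near x y" "\<not> near y z" | "\<not> near x y" "near y z"
    | "\<not> near x y" "\<not> near y z" "near x z" | "\<not> near x y" "\<not> near y z" "\<not> near x z" by blast
  then show ?thesis
  proof cases
    case 1
    then have xz: "near x z" by (rule near_trans)
    have "a (fst x + ?k x z) \<le> max (a (fst x + ?k x y)) (a (fst x + ?k y z))"
      using lcp_ultrametric[of "snd x" "snd y" "snd z"] a_antimono
      by (auto simp: le_max_iff_disj min_le_iff_disj)
    also have "\<dots> \<le> a (fst x + ?k x y) + a (fst x + ?k y z)"
      using a_pos[of "fst x + ?k x y"] a_pos[of "fst x + ?k y z"] by simp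
    finally show ?thesis using 1 xz ne by (simp add: nd_def) (simp add: near_def)
  next
    case 2
    then have "\<not> near x z" using near_trans near_commute by blast
    with 2 ne r show ?thesis using near_rho_diff[OF x y] by (simp add: nd_def) linarith
  next
    case 3
    then have "\<not> near x z" using near_trans near_commute by blast
    with 3 ne r show ?thesis using near_rho_diff[OF y z] by (simp add: nd_def) linarith
  next
    case 4
    then show ?thesis using ne near_rho(2)[OF x, of z] r by (auto simp: nd_def)
  next
    case 5
    then show ?thesis using ne r by (auto simp: nd_def)
  qed
qed

lemma nd_eq_0_iff:
  assumes x: "x \<in> nodes" and y: "y \<in> nodes"
  shows "nd x y = 0 \<longleftrightarrow> x = y"
proof -
  have "0 < nd x y" if ne: "x \<noteq> y"
  proof (cases "near x y")
    case False
    \<comment> \<open>The clause \<open>s = [] \<longrightarrow> m = 0\<close> of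
      \<open>nodes\<close> leaves just one node with empty list.\<close>
    have "snd x \<noteq> [] \<or> snd y \<noteq> []"
      using x y ne by (auto simp: nodes_def)
    then show ?thesis
      using False ne val_pos by (auto simp: nd_def rho_def less_max_iff_disj)
  qed (use ne a_pos in \<open>simp add: nd_def\<close>)
  then show ?thesis by (cases "x = y") (auto simp: nd_def)
qed

lemma Metric_space_nodes: "Metric_space nodes nd"
  by (intro Metric_space.intro nd_nonneg nd_commute nd_eq_0_iff nd_triangle)

lemma nd_centre: "nd (0, []) x = rho x"
  using rho_nonneg[of x] by (cases x) (auto simp: nd_def near_def rho_def)

lemma centre_in_nodes: "(0, []) \<in> nodes"
  by (simp add: nodes_def)

text \<open>The length is \<open>Suc k\<close> because cutting to length 0 would leave an empty
  list, which is allowed at scale 0 only.\<close>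

lemma nodes_take:
  assumes "(m, s) \<in> nodes"
  shows "(m, take (Suc k) s) \<in> nodes"
  using assms by (auto simp: nodes_def)
definition tree_nodes :: "'l list set \<Rightarrow> (nat \<times> 'l list) set" where
  "tree_nodes T = {x \<in> nodes. snd x = [] \<or> snd x \<in> T}"

text \<open>
  A limit of nodes that is not a node is the limit of a branch of the tree: nodes close to it share
  a long initial segment with each other.
\<close>

lemma branch_of_limit:
  fixes e :: "nat \<times> 'l list \<Rightarrow> 'u::metric_space"
  assumes e: "\<And>x y. x \<in> nodes \<Longrightarrow> y \<in> nodes \<Longrightarrow> dist (e x) (e y) = nd x y"
    and T: "\<And>s k. s \<in> T \<Longrightarrow> take k s \<in> T"
    and u: "u \<in> closure (e ` tree_nodes T)" "u \<notin> e ` tree_nodes T"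
  obtains m z where "\<And>k. (m, map z [0..<Suc k]) \<in> nodes" "\<And>k. map z [0..<Suc k] \<in> T"
    "(\<lambda>k. val (z k)) \<longlonglongrightarrow> dist (e (0, [])) u"
proof -
  let ?o = "(0, []) :: nat \<times> 'l list"
  have o: "?o \<in> tree_nodes T" using centre_in_nodes by (simp add: tree_nodes_def)
  have sub: "x \<in> nodes" if "x \<in> tree_nodes T" for x using that by (simp add: tree_nodes_def)
  have close: "\<exists>x\<in>tree_nodes T. dist (e x) u < r" if "0 < r" for r
    using u(1) that unfolding closure_approachable by auto
  have pos: "0 < dist (e x) u" if "x \<in> tree_nodes T" for x
    using u(2) that by auto
  define r where "r = dist (e ?o) u"
  have "0 < r" using pos[OF o] by (simp add: r_def)
  obtain x0 where x0: "x0 \<in> tree_nodes T" "dist (e x0) u < r / 4"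
    using close[of "r / 4"] \<open>0 < r\<close> by auto
  define m where "m = fst x0"
  have rho_x0: "r - r / 4 < rho x0"
  proof -
    have "r \<le> dist (e ?o) (e x0) + dist (e x0) u" unfolding r_def by (rule dist_triangle)
    also have "dist (e ?o) (e x0) = rho x0"
      using e[OF sub[OF o] sub[OF x0(1)]] by (simp add: nd_centre)
    finally show ?thesis using x0(2) by simp
  qed
  \<comment> \<open>Nodes of different scale are at the maximum of their values, which is above
    \<open>3 * r / 4\<close>, whereas both are within \<open>r / 4\<close> of
    \<open>u\<close>.\<close>
  have m: "fst x = m" if "x \<in> tree_nodes T" "dist (e x) u < r / 4" for x
  proof (rule ccontr)
    assume "fst x \<noteq> m"
    then have "nd x0 x = max (rho x0) (rho x)" by (auto simp: nd_def near_def m_def)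
    moreover have "nd x0 x = dist (e x0) (e x)"
      using e[OF sub[OF x0(1)] sub[OF that(1)]] by simp
    moreover have "dist (e x0) (e x) \<le> dist (e x0) u + dist (e x) u" by (rule dist_triangle2)
    ultimately show False using rho_x0 x0(2) that(2) \<open>0 < r\<close> by auto
  qed
  define good where "good k x \<longleftrightarrow> x \<in> tree_nodes T \<and> fst x = m \<and> k < length (snd x) \<and>
    dist (e x) u < min (a (m + k) / 2) (r / 4)" for k x
  \<comment> \<open>The nodes are closer to each other than \<open>a (m + k)\<close>, and too close
    to be at the maximum of their values, so they are near with a common prefix of length at least
    \<open>k\<close>.\<close>
  have agree: "take k (snd x) = take k (snd y)" if x: "good k x" and y: "good k' y" and k: "k \<le> k'"
    for k k' x y
  proof (cases "x = y")
    case False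
    have xy: "x \<in> nodes" "y \<in> nodes" using x y sub by (auto simp: good_def)
    have "dist (e x) (e y) \<le> dist (e x) u + dist (e y) u" by (rule dist_triangle2)
    also have "\<dots> < a (m + k) / 2 + a (m + k') / 2 "
      using x y by (auto simp: good_def intro: add_strict_mono)
    also have "\<dots> \<le> a (m + k)" using a_antimono[of "m + k" "m + k'"] k by simp
    finally have lt: "nd x y < a (m + k)" using e[OF xy] by simp
    have lt_r: "nd x y < r / 2"
    proof -
      have "dist (e x) (e y) \<le> dist (e x) u + dist (e y) u" by (rule dist_triangle2)
      then show ?thesis using e[OF xy] x y by (simp add: good_def)
    qed
    have "near x y"
    proof (rule ccontr)
      assume "\<not> near x y"
      then have "rho x \<le> nd x y" using False by (simp add: nd_def)
      moreover have "r \<le> rho x + dist (e x) u"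
        using dist_triangle[of "e ?o" u "e x"] e[OF sub[OF o] xy(1)]
        by (simp add: nd_centre r_def)
      moreover have "dist (e x) u < r / 4" using x by (simp add: good_def)
      ultimately show False using lt_r \<open>0 < r\<close> by linarith
    qed
    then have "a (m + lcp (snd x) (snd y)) < a (m + k)"
      using lt False x by (simp add: nd_def good_def)
    then have "k \<le> lcp (snd x) (snd y)"
      using a_antimono[of "m + lcp (snd x) (snd y)" "m + k"] by (cases "k \<le> lcp (snd x) (snd y)") auto
    then show ?thesis by (simp add: le_lcp_iff)
  qed simp
  have "\<exists>x. good k x" for k
  proof -
    let ?d = "min (a (m + k) / 2) (r / 4)"
    have d: "0 < ?d" using a_pos \<open>0 < r\<close> by simp
    obtain x where x: "x \<in> tree_nodes T" "dist (e x) u < ?d" using close[OF d] by auto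
    \<comment> \<open>As \<open>u\<close> is not a node, there is a node strictly closer to
      \<open>u\<close> than \<open>x\<close>, hence distinct from it. Their small nonzero distance
      forces a common prefix longer than \<open>k\<close>, so \<open>x\<close> has more than
      \<open>k\<close> labels.\<close>
    obtain y where y: "y \<in> tree_nodes T" "dist (e y) u < min ?d (dist (e x) u)"
      using close[of "min ?d (dist (e x) u)"] d pos[OF x(1)] by auto
    have ne: "x \<noteq> y" using y(2) by auto
    have xy: "x \<in> nodes" "y \<in> nodes" using x y sub by auto
    have dxy: "nd x y \<le> dist (e x) u + dist (e y) u"
      using e[OF xy] dist_triangle2[of "e x" "e y" u] by simp
    have m': "fst x = m" "fst y = m" using m x y by auto
    have "near x y"
    proof (rule ccontr)
      assume "\<not> near x y"
      then have "rho x \<le> nd x y" using ne by (simp add: nd_def)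
      moreover have "r \<le> rho x + dist (e x) u"
        using dist_triangle[of "e ?o" u "e x"] e[OF sub[OF o] xy(1)]
        by (simp add: nd_centre r_def)
      ultimately show False using dxy x(2) y(2) \<open>0 < r\<close> by (simp add: min_def split: if_splits)
    qed
    then have "nd x y = a (m + lcp (snd x) (snd y))" using ne m' by (simp add: nd_def)
    moreover have "nd x y < a (m + k)" using dxy x(2) y(2) by simp
    ultimately have "k < lcp (snd x) (snd y)"
      using a_antimono[of "m + lcp (snd x) (snd y)" "m + k"] by (cases "k < lcp (snd x) (snd y)") auto
    then have "k < length (snd x)"
      using le_lcp_iff[of "lcp (snd x) (snd y)" "snd x" "snd y"] by simp
    then show ?thesis using x m' by (intro exI[of _ x]) (simp add: good_def)
  qed
  then obtain S where S: "\<And>k. good k (S k)" by metis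
  define z where "z i = snd (S (Suc i)) ! i" for i
  have z: "map z [0..<k] = take k (snd (S k))" for k
  proof (rule nth_equalityI)
    show "length (map z [0..<k]) = length (take k (snd (S k)))" using S[of k] by (simp add: good_def)
    fix i assume "i < length (map z [0..<k])"
    then have i: "i < k" by simp
    from agree[OF S[of "Suc i"] S[of k]] i
    have "take (Suc i) (snd (S (Suc i))) = take (Suc i) (snd (S k))" by simp
    then have "snd (S (Suc i)) ! i = snd (S k) ! i" by (metis lessI nth_take)
    then show "map z [0..<k] ! i = take k (snd (S k)) ! i" using i by (simp add: z_def)
  qed
  define x where "x k = (m, map z [0..<Suc k])" for k
  have S': "S k = (m, snd (S k))" "S k \<in> nodes" "snd (S k) \<in> T" for k
    using S[of k] by (auto simp: good_def tree_nodes_def prod_eq_iff)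
  have nodes: "x k \<in> nodes" for k
    using nodes_take[of m "snd (S (Suc k))" k] S'[of "Suc k"] by (simp only: x_def z)
  have inT: "map z [0..<Suc k] \<in> T" for k
    using T S'[of "Suc k"] by (simp only: z)
  have lim: "(\<lambda>k. e (x k)) \<longlonglongrightarrow> u"
  proof (rule metric_LIMSEQ_I)
    fix \<epsilon> :: real assume "0 < \<epsilon>"
    then obtain N where N: "\<And>n. n \<ge> N \<Longrightarrow> a n < \<epsilon> / 2"
      using order_tendstoD(2)[OF a_lim, of "\<epsilon> / 2"] unfolding eventually_sequentially by auto
    have "dist (e (x k)) u < \<epsilon>" if "k \<ge> N" for k
    proof -
      \<comment> \<open>\<open>x k\<close> is this node cut to length \<open>Suc k\<close>, which
        moves it by at most \<open>a (m + Suc k)\<close>.\<close>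
      let ?y = "S (Suc k)"
      have y: "?y \<in> nodes" "Suc k < length (snd ?y)" using S'(2) S[of "Suc k"] by (auto simp: good_def)
      have "lcp (snd (x k)) (snd ?y) = Suc k"
        using y(2) lcp_take[of "Suc k" "snd ?y"] by (simp only: x_def z snd_conv)
      then have "nd (x k) ?y \<le> a (m + Suc k)"
        using S'(1)[of "Suc k"] a_pos[of "m + Suc k"]
        by (auto simp: nd_def near_def x_def less_imp_le prod_eq_iff simp del: upt_Suc)
      moreover have "dist (e (x k)) u \<le> nd (x k) ?y + dist (e ?y) u"
        using dist_triangle[of "e (x k)" u "e ?y"] e[OF nodes y(1)] by simp
      moreover have "dist (e ?y) u < a (m + Suc k) / 2" using S[of "Suc k"] by (simp add: good_def)
      moreover have "a (m + Suc k) < \<epsilon> / 2" by (rule N) (use that in simp)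
      ultimately show ?thesis using a_pos[of "m + Suc k"] by linarith
    qed
    then show "\<exists>N. \<forall>k\<ge>N. dist (e (x k)) u < \<epsilon>" by blast
  qed
  have "val (z k) = dist (e ?o) (e (x k))" for k
    using e[OF sub[OF o] nodes] by (simp add: nd_centre rho_def x_def)
  then have "(\<lambda>k. val (z k)) \<longlonglongrightarrow> dist (e ?o) u"
    using tendsto_dist[OF tendsto_const lim] by simp
  then show thesis using that nodes inT by (auto simp: x_def simp del: upt_Suc)
qed

text \<open>The truncations of a branch form a Cauchy sequence, and the distance of its limit from
  the centre is the limit of the values. Conversely, \<open>branch_of_limit\<close> controls all
  distances from the centre, and these determine every other distance up to values of
  \<open>a\<close>.\<close>

lemma closure_tree_nodes_in_\<V>_iff:
  fixes e :: "nat \<times> 'l list \<Rightarrow> 'u::complete_space"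
  assumes e: "\<And>x y. x \<in> nodes \<Longrightarrow> y \<in> nodes \<Longrightarrow> dist (e x) (e y) = nd x y"
    and T: "\<And>s k. s \<in> T \<Longrightarrow> take k s \<in> T"
    and A: "0 \<in> A" "range a \<subseteq> A" "range val \<subseteq> A"
  shows "closure (e ` tree_nodes T) \<in> \<V> A \<longleftrightarrow>
    (\<forall>m z v. (\<forall>k. (m, map z [0..<Suc k]) \<in> nodes \<and> map z [0..<Suc k] \<in> T) \<longrightarrow>
      (\<lambda>k. val (z k)) \<longlonglongrightarrow> v \<longrightarrow> v \<in> A)" (is "_ \<longleftrightarrow> ?branches")
proof -
  let ?o = "(0, []) :: nat \<times> 'l list"
  let ?P = "e ` tree_nodes T"
  have o: "?o \<in> tree_nodes T" using centre_in_nodes by (simp add: tree_nodes_def)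
  have sub: "x \<in> nodes" if "x \<in> tree_nodes T" for x using that by (simp add: tree_nodes_def)
  have rho: "dist (e ?o) (e x) = rho x" if "x \<in> nodes" for x
    using e[OF sub[OF o] that] by (simp add: nd_centre)
  show ?thesis
  proof
    assume "closure ?P \<in> \<V> A"
    then have dA: "dist u v \<in> A" if "u \<in> closure ?P" "v \<in> closure ?P" for u v
      using that by (auto simp: \<V>_def distances_def)
    show ?branches
    proof (intro allI impI)
      fix m z v assume *: "\<forall>k. (m, map z [0..<Suc k]) \<in> nodes \<and> map z [0..<Suc k] \<in> T"
        and v: "(\<lambda>k. val (z k)) \<longlonglongrightarrow> v"
      define x where "x k = (m, map z [0..<Suc k])" for k
      have x: "x k \<in> nodes" "x k \<in> tree_nodes T" for k
        using * by (auto simp: x_def tree_nodes_def simp del: upt_Suc)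
      have "dist (e (x j)) (e (x k)) \<le> a j" if "j \<le> k" for j k
      proof -
        have "take (Suc j) (map z [0..<Suc k]) = map z [0..<Suc j]"
          using that by (simp add: take_map del: upt_Suc)
        then have "lcp (snd (x j)) (snd (x k)) = Suc j"
          using lcp_take[of "Suc j" "map z [0..<Suc k]"] that by (simp add: x_def del: upt_Suc)
        then have "nd (x j) (x k) \<le> a (m + Suc j)"
          using a_pos[of "m + Suc j"] by (auto simp: nd_def near_def x_def less_imp_le simp del: upt_Suc)
        also have "\<dots> \<le> a j" by (rule a_antimono) simp
        finally show ?thesis using e[OF x(1) x(1)] by simp
      qed
      then have le: "dist (e (x j)) (e (x k)) \<le> a (min j k)" for j k
        by (metis dist_commute min.absorb1 min.absorb2 nat_le_linear)
      have "Cauchy (\<lambda>k. e (x k))"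
      proof (rule metric_CauchyI)
        fix \<epsilon> :: real assume "0 < \<epsilon>"
        then obtain N where N: "\<And>n. n \<ge> N \<Longrightarrow> a n < \<epsilon>"
          using order_tendstoD(2)[OF a_lim, of "\<epsilon>"] unfolding eventually_sequentially by auto
        then show "\<exists>N. \<forall>j\<ge>N. \<forall>k\<ge>N. dist (e (x j)) (e (x k)) < \<epsilon>"
          using le by (intro exI[of _ N]) (meson le_less_trans min.boundedI)
      qed
      then obtain u where u: "(\<lambda>k. e (x k)) \<longlonglongrightarrow> u"
        using Cauchy_convergent convergentD by blast
      have "u \<in> closure ?P"
        unfolding closure_sequential using x u by (intro exI[of _ "\<lambda>k. e (x k)"]) simp
      moreover have "e ?o \<in> closure ?P" using o closure_subset[of ?P] by auto
      moreover have "dist (e ?o) u = v"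
      proof (rule LIMSEQ_unique)
        show "(\<lambda>k. dist (e ?o) (e (x k))) \<longlonglongrightarrow> dist (e ?o) u"
          by (intro tendsto_dist tendsto_const u)
        show "(\<lambda>k. dist (e ?o) (e (x k))) \<longlonglongrightarrow> v"
          using v by (simp add: rho[OF x(1)]) (simp add: rho_def x_def)
      qed
      ultimately show "v \<in> A" using dA by blast
    qed
  next
    assume br: ?branches
    have rho_A: "dist (e ?o) u \<in> A" if u: "u \<in> closure ?P" for u
    proof (cases "u \<in> ?P")
      case True
      then obtain x where "x \<in> tree_nodes T" "u = e x" by auto
      then show ?thesis using A rho[OF sub] by (auto simp: rho_def)
    next
      case False
      show ?thesis
      proof (rule branch_of_limit[OF e T u False])
        fix m z
        assume *: "\<And>k. (m, map z [0..<Suc k]) \<in> nodes" "\<And>k. map z [0..<Suc k] \<in> T"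
          and lim: "(\<lambda>k. val (z k)) \<longlonglongrightarrow> dist (e ?o) u"
        have "\<forall>k. (m, map z [0..<Suc k]) \<in> nodes \<and> map z [0..<Suc k] \<in> T" using * by blast
        with br lim show ?thesis by blast
      qed
    qed
    define Z where "Z = insert 0 (range a)"
    \<comment> \<open>The dichotomy for distances of nodes, stated as a closed condition so that it
      passes to the closure; adding 0 makes the range of \<open>a\<close> closed.\<close>
    define G where "G = {p :: 'u \<times> 'u. dist (fst p) (snd p) \<in> Z \<or>
      dist (fst p) (snd p) = max (dist (e ?o) (fst p)) (dist (e ?o) (snd p))}"
    have "compact Z" unfolding Z_def by (rule compact_sequence_with_limit[OF a_lim])
    then have "closed Z" by (rule compact_imp_closed)
    have "closed G"
    proof -
      have "closed ((\<lambda>p :: 'u \<times> 'u. dist (fst p) (snd p)) -` Z)"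
        by (intro closed_vimage \<open>closed Z\<close> continuous_intros)
      moreover have "closed {p :: 'u \<times> 'u.
          dist (fst p) (snd p) = max (dist (e ?o) (fst p)) (dist (e ?o) (snd p))}"
        by (intro closed_Collect_eq continuous_intros)
      ultimately show ?thesis unfolding G_def vimage_def by (rule closed_Collect_disj[OF _ _, unfolded mem_Collect_eq])
    qed
    moreover have "?P \<times> ?P \<subseteq> G"
    proof clarify
      fix x y assume "x \<in> tree_nodes T" "y \<in> tree_nodes T"
      then have "x \<in> nodes" "y \<in> nodes" using sub by auto
      then show "(e x, e y) \<in> G" using rho e by (auto simp: G_def Z_def nd_def)
    qed
    ultimately have G: "closure ?P \<times> closure ?P \<subseteq> G"
      using closure_minimal closure_Times by metis
    have "dist u v \<in> A" if "u \<in> closure ?P" "v \<in> closure ?P" for u v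
    proof -
      have "(u, v) \<in> G" using G that by auto
      then have "dist u v \<in> Z \<or> dist u v = dist (e ?o) u \<or> dist u v = dist (e ?o) v"
        by (auto simp: G_def max_def)
      then show ?thesis using A rho_A that by (auto simp: Z_def)
    qed
    moreover have "closure ?P \<noteq> {}" using o by auto
    ultimately show "closure ?P \<in> \<V> A"
      by (auto simp: \<V>_def distances_def nonempty_closed_def)
  qed
qed

end


section \<open>Borel maps into the Effros Borel space\<close>

lemma space_effros [simp]: "space effros = nonempty_closed"
  by (auto simp: effros_def space_measure_of_conv)

lemma sets_effros_meets [measurable]:
  assumes "open W"
  shows "{X \<in> nonempty_closed. X \<inter> W \<noteq> {}} \<in> sets effros"
  unfolding effros_def using assms
  by (subst sets_measure_of) (auto intro: sigma_sets.Basic)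

lemma measurable_effrosI:
  fixes f :: "'x \<Rightarrow> 'u::topological_space set"
  assumes "\<And>x. x \<in> space M \<Longrightarrow> f x \<in> nonempty_closed"
    and "\<And>W. open W \<Longrightarrow> {x \<in> space M. f x \<inter> W \<noteq> {}} \<in> sets M"
  shows "f \<in> M \<rightarrow>\<^sub>M effros"
  unfolding effros_def
proof (rule measurable_measure_of)
  fix Y :: "'u set set" assume "Y \<in> {{X \<in> nonempty_closed. X \<inter> W \<noteq> {}} |W. open W}"
  then obtain W where "open W" "Y = {X \<in> nonempty_closed. X \<inter> W \<noteq> {}}" by auto
  moreover from this have "f -` Y \<inter> space M = {x \<in> space M. f x \<inter> W \<noteq> {}}"
    using assms(1) by auto
  ultimately show "f -` Y \<inter> space M \<in> sets M" using assms(2) by simp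
qed (use assms(1) in auto)

text \<open>An open set meets a closure iff it meets the set itself, which here is a union over
  countably many nodes.\<close>

lemma measurable_closure_image:
  fixes N :: "'x \<Rightarrow> 'n::countable set" and e :: "'n \<Rightarrow> 'u::topological_space"
  assumes N: "\<And>n. {x \<in> space M. n \<in> N x} \<in> sets M" and ne: "\<And>x. x \<in> space M \<Longrightarrow> N x \<noteq> {}"
  shows "(\<lambda>x. closure (e ` N x)) \<in> M \<rightarrow>\<^sub>M effros"
proof (rule measurable_effrosI)
  show "closure (e ` N x) \<in> nonempty_closed" if "x \<in> space M" for x
    using ne[OF that] by (simp add: nonempty_closed_def)
  fix W :: "'u set" assume "open W"
  then have "{x \<in> space M. closure (e ` N x) \<inter> W \<noteq> {}} =
      (\<Union>n\<in>{n. e n \<in> W}. {x \<in> space M. n \<in> N x})"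
    by (auto simp: Int_commute[of _ W] open_Int_closure_eq_empty)
  also have "\<dots> \<in> sets M"
    by (intro sets.countable_UN') (auto intro: N)
  finally show "{x \<in> space M. closure (e ` N x) \<inter> W \<noteq> {}} \<in> sets M" .
qed

section \<open>The reduction to \<open>\<V> A\<close>\<close>

lemma decseq_in_limit_point:
  fixes A :: "real set"
  assumes "A \<subseteq> {0..}" "0 islimpt A"
  obtains a where "\<And>n :: nat. a n \<in> A" "\<And>n. 0 < a n" "decseq a" "a \<longlonglongrightarrow> 0"
proof -
  have ex: "\<exists>r\<in>A. 0 < r \<and> r < \<epsilon>" if \<epsilon>: "0 < \<epsilon>" for \<epsilon>
  proof -
    obtain r where "r \<in> A" "r \<noteq> 0" "dist r 0 < \<epsilon>"
      using assms(2) \<epsilon> unfolding islimpt_approachable by blast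
    then show ?thesis using assms(1) by (intro bexI[of _ r]) auto
  qed
  have "\<exists>a. \<forall>n. (a n \<in> A \<and> 0 < a n \<and> a n < 1 / real (Suc n)) \<and> a (Suc n) \<le> a n"
  proof (rule dependent_nat_choice)
    show "\<exists>r. r \<in> A \<and> 0 < r \<and> r < 1 / real (Suc 0)" using ex[of 1] by auto
    fix r n assume "r \<in> A \<and> 0 < r \<and> r < 1 / real (Suc n)"
    then show "\<exists>s. (s \<in> A \<and> 0 < s \<and> s < 1 / real (Suc (Suc n))) \<and> s \<le> r"
      using ex[of "min r (1 / real (Suc (Suc n)))"] by (auto intro: less_imp_le)
  qed
  then obtain a where a: "\<And>n. a n \<in> A" "\<And>n. 0 < a n" "\<And>n. a n < 1 / real (Suc n)"
    "\<And>n. a (Suc n) \<le> a n" by blast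
  have "a \<longlonglongrightarrow> 0"
    by (rule tendsto_sandwich[OF _ _ tendsto_const LIMSEQ_inverse_real_of_nat])
      (use a in \<open>auto intro!: always_eventually less_imp_le simp: inverse_eq_divide\<close>)
  moreover have "decseq a" using a(4) by (rule decseq_SucI)
  ultimately show thesis using a(1,2) that by blast
qed

text \<open>Both hardness results follow by choosing \<open>C\<close>. A branch carries a sequence
  in \<open>A\<close> converging to \<open>v\<close>, the point \<open>y\<close>, and a Souslin
  witness for \<open>(x, v, y) \<in> C\<close>; the closed set leaves \<open>\<V> A\<close> iff some
  such \<open>v\<close> is outside \<open>A\<close>.\<close>

lemma effros_reduction:
  fixes A :: "real set" and X :: "'x measure"
  assumes U: "universal_metric TYPE('u::polish_space)"
    and A: "A \<subseteq> {0..}" "0 \<in> A" "0 islimpt A"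
    and C: "C \<in> sets (X \<Otimes>\<^sub>M ((borel :: real measure) \<Otimes>\<^sub>M baire))"
  obtains f where "f \<in> X \<rightarrow>\<^sub>M (effros :: 'u set measure)"
    "\<And>x. x \<in> space X \<Longrightarrow> f x \<in> \<V> A \<longleftrightarrow> (\<forall>v y. v \<in> closure A \<longrightarrow> (x, v, y) \<in> C \<longrightarrow> v \<in> A)"
proof -
  obtain a where a: "\<And>n :: nat. a n \<in> A" "\<And>n. 0 < a n" "decseq a" "a \<longlonglongrightarrow> 0"
    using decseq_in_limit_point[OF A(1,3)] by metis
  \<comment> \<open>Node values come from a countable dense part of \<open>A\<close>, so that there
    are countably many nodes; 0 is removed as values must be positive.\<close>
  obtain D where D: "countable D" "D \<subseteq> A - {0}" "A - {0} \<subseteq> closure D"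
    using separable[of "A - {0}"] by metis
  have "D \<noteq> {}" using D(3) a(1,2)[of 0] by auto
  define q where "q = from_nat_into D"
  have range_q: "range q = D" using D(1) \<open>D \<noteq> {}\<close> by (simp add: q_def range_from_nat_into)
  have q: "q i \<in> A" "0 < q i" for i
  proof -
    have "q i \<in> A - {0}" using range_q D(2) by blast
    with A(1) show "q i \<in> A" "0 < q i" by auto
  qed
  have dense: "\<exists>i. \<bar>q i - v\<bar> < \<epsilon>" if v: "v \<in> closure A" "v \<noteq> 0" and \<epsilon>: "0 < \<epsilon>" for v \<epsilon>
  proof -
    have "closure A \<subseteq> insert 0 (closure (A - {0}))"
      by (metis closure_insert insert_Diff A(2) order_refl)
    also have "closure (A - {0}) \<subseteq> closure D" using D(3) by (simp add: closure_minimal)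
    finally have "v \<in> closure (range q)" using v range_q by auto
    then show ?thesis using \<epsilon> unfolding closure_approachable by (auto simp: dist_real_def)
  qed
  \<comment> \<open>A label pairs an entry of \<open>z\<close> with an entry of the witness
    \<open>w\<close>; the entry of \<open>z\<close> in turn codes an index into \<open>D\<close> and
    an entry of \<open>y\<close>.\<close>
  define val where "val l = q (fst (prod_decode (fst l)))" for l :: "nat \<times> nat"
  interpret tree_metric a val
    by unfold_locales (use a q in \<open>auto simp: val_def\<close>)
  obtain e :: "nat \<times> (nat \<times> nat) list \<Rightarrow> 'u"
    where e: "\<And>x y. x \<in> nodes \<Longrightarrow> y \<in> nodes \<Longrightarrow> dist (e x) (e y) = nd x y"
    using universal_metric_countable[OF U Metric_space_nodes countableI_type] by metis
  \<comment> \<open>Replacing the real \<open>v\<close> by a sequence of indices brings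
    \<open>C\<close> back to a subset of \<open>X\<close> times the Baire space. The value of
    \<open>lim\<close> at divergent sequences does no harm, since only convergent branches are
    tested.\<close>
  define g where "g p = (fst p, lim (\<lambda>k. q (left (snd p) k)), right (snd p))"
    for p :: "'x \<times> (nat \<Rightarrow> nat)"
  have g: "g \<in> X \<Otimes>\<^sub>M baire \<rightarrow>\<^sub>M X \<Otimes>\<^sub>M (borel \<Otimes>\<^sub>M baire)"
    unfolding g_def by measurable
  define C' where "C' = g -` C \<inter> space (X \<Otimes>\<^sub>M baire)"
  have "C' \<in> sets (X \<Otimes>\<^sub>M baire)" unfolding C'_def by (rule measurable_sets[OF g C])
  then obtain R where R: "souslin_scheme X R C'"
    using sets_pair_baire_souslin unfolding souslin_def by blast
  then have R_sets [measurable]: "R s t \<in> sets X" for s t by (simp add: souslin_scheme_def)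
  have C'_iff: "(x, lim (\<lambda>k. q (left z k)), right z) \<in> C \<longleftrightarrow>
      (\<exists>w. \<forall>n. x \<in> R (map z [0..<n]) (map w [0..<n]))" if "x \<in> space X" for x z
  proof -
    have "(x, z) \<in> C' \<longleftrightarrow> (x, lim (\<lambda>k. q (left z k)), right z) \<in> C"
      using that by (simp add: C'_def g_def space_pair_measure)
    then show ?thesis using R that by (simp add: souslin_scheme_def)
  qed
  \<comment> \<open>Imposing the conditions for all shorter segments makes \<open>T x\<close> closed
    under initial segments.\<close>
  define T where "T x = {s. \<forall>n\<le>length s. x \<in> R (map fst (take n s)) (map snd (take n s))}" for x
  have T_take: "take k s \<in> T x" if "s \<in> T x" for s k x
    using that by (auto simp: T_def min_def)
  define f where "f x = closure (e ` tree_nodes (T x))" for x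
  show thesis
  proof
    have "{x \<in> space X. n \<in> tree_nodes (T x)} \<in> sets X" for n
    proof -
      have "{x \<in> space X. n \<in> tree_nodes (T x)} = {x \<in> space X. n \<in> nodes \<and> (snd n = [] \<or>
        (\<forall>k\<in>{..length (snd n)}. x \<in> R (map fst (take k (snd n))) (map snd (take k (snd n)))))}"
        by (auto simp: tree_nodes_def T_def)
      then show ?thesis by simp
    qed
    moreover have "tree_nodes (T x) \<noteq> {}" for x
      using centre_in_nodes by (auto simp: tree_nodes_def)
    ultimately show "f \<in> X \<rightarrow>\<^sub>M effros"
      unfolding f_def by (rule measurable_closure_image)
    fix x assume x: "x \<in> space X"
    have T_iff: "(\<forall>k. map z [0..<Suc k] \<in> T x) \<longleftrightarrow>
      (\<forall>n. x \<in> R (map (fst \<circ> z) [0..<n]) (map (snd \<circ> z) [0..<n]))" for z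
    proof
      assume *: "\<forall>k. map z [0..<Suc k] \<in> T x"
      show "\<forall>n. x \<in> R (map (fst \<circ> z) [0..<n]) (map (snd \<circ> z) [0..<n])"
      proof
        fix n
        from *[rule_format, of n, unfolded T_def, simplified, rule_format, of n]
        show "x \<in> R (map (fst \<circ> z) [0..<n]) (map (snd \<circ> z) [0..<n])" by simp
      qed
    qed (auto simp: T_def take_map simp del: upt_Suc)
    have "f x \<in> \<V> A \<longleftrightarrow>
      (\<forall>m z v. (\<forall>k. (m, map z [0..<Suc k]) \<in> nodes \<and> map z [0..<Suc k] \<in> T x) \<longrightarrow>
        (\<lambda>k. val (z k)) \<longlonglongrightarrow> v \<longrightarrow> v \<in> A)" (is "_ \<longleftrightarrow> ?branches")
      unfolding f_def
      by (rule closure_tree_nodes_in_\<V>_iff[OF e T_take A(2)]) (use a q in \<open>auto simp: val_def\<close>)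
    also have "?branches \<longleftrightarrow> (\<forall>v y. v \<in> closure A \<longrightarrow> (x, v, y) \<in> C \<longrightarrow> v \<in> A)" (is "_ \<longleftrightarrow> ?values")
    proof
      assume ?values
      show ?branches
      proof (intro allI impI)
        fix m z v
        assume *: "\<forall>k. (m, map z [0..<Suc k]) \<in> nodes \<and> map z [0..<Suc k] \<in> T x"
          and v: "(\<lambda>k. val (z k)) \<longlonglongrightarrow> v"
        have "val (z k) \<in> A" for k by (simp add: val_def q)
        with v have "v \<in> closure A"
          unfolding closure_sequential by (intro exI[of _ "\<lambda>k. val (z k)"]) simp
        moreover have "lim (\<lambda>k. q (left (fst \<circ> z) k)) = v"
          using v by (intro limI) (simp add: val_def left_def)
        then have "(x, v, right (fst \<circ> z)) \<in> C"
          using C'_iff[OF x, of "fst \<circ> z"] T_iff[of z] * by auto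
        ultimately show "v \<in> A" using \<open>?values\<close> by blast
      qed
    next
      assume br: ?branches
      show ?values
      proof (intro allI impI)
        fix v y assume v: "v \<in> closure A" "(x, v, y) \<in> C"
        show "v \<in> A"
        \<comment> \<open>For \<open>v = 0\<close> the claim is \<open>0 \<in> A\<close>. Otherwise
          \<open>v\<close> is positive and some scale \<open>m\<close> has \<open>a m\<close> well
          below it.\<close>
        proof (cases "v = 0")
          case False
          have "closure A \<subseteq> {0..}" using A(1) by (intro closure_minimal) auto
          then have "0 < v" using v(1) False by auto
          obtain m where m: "a m < v / 2"
            using order_tendstoD(2)[OF a(4), of "v / 2"] \<open>0 < v\<close>
            unfolding eventually_sequentially by auto
          \<comment> \<open>Errors of a quarter put two entries within the half demanded by
            \<open>nodes\<close>, and with \<open>a m < v / 2\<close> they keep the values above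
            \<open>a m\<close>.\<close>
          have "\<exists>i. \<bar>q i - v\<bar> < a (m + Suc k) / 4" for k
            by (rule dense[OF v(1) False]) (simp add: a(2))
          then obtain i where i: "\<And>k. \<bar>q (i k) - v\<bar> < a (m + Suc k) / 4" by metis
          have lim: "(\<lambda>k. q (i k)) \<longlonglongrightarrow> v"
          proof -
            have "(\<lambda>k. a (k + Suc m) / 4) \<longlonglongrightarrow> 0 / 4"
              by (rule tendsto_divide[OF LIMSEQ_ignore_initial_segment[OF a(4)] tendsto_const]) simp
            then have "(\<lambda>k. a (m + Suc k) / 4) \<longlonglongrightarrow> 0" by (simp add: add.commute)
            then have "(\<lambda>k. q (i k) - v) \<longlonglongrightarrow> 0"
              by (rule Lim_null_comparison[rotated]) (use i in \<open>auto intro!: always_eventually less_imp_le\<close>)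
            then show ?thesis by (simp add: LIM_zero_iff)
          qed
          then have "(x, lim (\<lambda>k. q (left (join i y) k)), right (join i y)) \<in> C"
            using v(2) by (simp add: limI)
          then obtain w where w: "\<And>n. x \<in> R (map (join i y) [0..<n]) (map w [0..<n])"
            using C'_iff[OF x] by blast
          define z where "z k = (join i y k, w k)" for k
          have val_z: "val (z k) = q (i k)" for k by (simp add: val_def z_def join_def)
          have "fst \<circ> z = join i y" "snd \<circ> z = w" by (auto simp: z_def)
          then have "\<forall>k. map z [0..<Suc k] \<in> T x" using w T_iff[of z] by simp
          moreover have "(m, map z [0..<Suc k]) \<in> nodes" for k
          proof -
            have "\<bar>q (i j) - q (i l)\<bar> \<le> a (m + Suc j) / 2" if "j \<le> l" for j l
            proof -
              have "a (m + Suc l) \<le> a (m + Suc j)" using that by (intro a_antimono) simp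
              then show ?thesis using i[of j] i[of l] by linarith
            qed
            moreover have "a m \<le> q (i l)" for l
            proof -
              have "a (m + Suc l) \<le> a m" by (intro a_antimono) simp
              then show ?thesis using i[of l] m by linarith
            qed
            ultimately show ?thesis by (simp add: nodes_def val_z del: upt_Suc)
          qed
          moreover have "(\<lambda>k. val (z k)) \<longlonglongrightarrow> v" using lim by (simp add: val_z)
          ultimately show ?thesis using br by blast
        qed (simp add: A)
      qed
    qed
    finally show "f x \<in> \<V> A \<longleftrightarrow> (\<forall>v y. v \<in> closure A \<longrightarrow> (x, v, y) \<in> C \<longrightarrow> v \<in> A)" .
  qed
qed


section \<open>The complexity of \<open>\<V> A\<close>\<close>

lemma sets_mem_effros:
  fixes g :: "'x \<Rightarrow> 'u::polish_space set"
  assumes g: "g \<in> M \<rightarrow>\<^sub>M effros" and h: "h \<in> M \<rightarrow>\<^sub>M borel"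
  shows "{x \<in> space M. h x \<in> g x} \<in> sets M"
proof -
  obtain B :: "'u set set" where B: "countable B" "topological_basis B"
    using ex_countable_basis by auto
  have open_B: "open W" if "W \<in> B" for W using that B(2) by (rule topological_basis_open[rotated])
  have closed: "closed (g x)" if "x \<in> space M" for x
    using measurable_space[OF g that] by (simp add: nonempty_closed_def)
  \<comment> \<open>A point lies in a closed set iff each of its basic neighbourhoods meets the
    set.\<close>
  have "{x \<in> space M. h x \<in> g x} =
      space M - (\<Union>W\<in>B. (h -` W \<inter> space M) - (g -` {X \<in> nonempty_closed. X \<inter> W \<noteq> {}} \<inter> space M))"
    (is "?l = ?r")
  proof (intro equalityI subsetI)
    fix x assume x: "x \<in> ?r"
    show "x \<in> ?l"
    proof (rule ccontr)
      assume "x \<notin> ?l"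
      then have "h x \<in> - g x" "open (- g x)" using x closed by auto
      then obtain W where "W \<in> B" "h x \<in> W" "W \<subseteq> - g x"
        using topological_basisE[OF B(2)] by metis
      then show False using x by auto
    qed
  next
    fix x assume "x \<in> ?l"
    then show "x \<in> ?r" using measurable_space[OF g] by auto
  qed
  also have "\<dots> \<in> sets M"
  proof -
    have "(h -` W \<inter> space M) - (g -` {X \<in> nonempty_closed. X \<inter> W \<noteq> {}} \<inter> space M) \<in> sets M"
      if "W \<in> B" for W
      using open_B[OF that]
      by (intro sets.Diff measurable_sets[OF h] borel_open measurable_sets[OF g] sets_effros_meets)
    then show ?thesis using B(1) by (intro sets.Diff[OF sets.top] sets.countable_UN'')
  qed
  finally show ?thesis .
qed

text \<open>Sequences of indices into a countable dense set are sent to limits. This lets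
  quantifiers over points of the space be replaced by quantifiers over the Baire space, along which
  the projective classes project.\<close>

lemma baire_borel_surjection:
  obtains p :: "(nat \<Rightarrow> nat) \<Rightarrow> 'u::polish_space" where "p \<in> baire \<rightarrow>\<^sub>M borel" "surj p"
proof -
  obtain D :: "'u set" where D: "countable D" "\<And>W. open W \<Longrightarrow> W \<noteq> {} \<Longrightarrow> \<exists>d\<in>D. d \<in> W"
    by (rule countable_dense_setE) blast
  have "D \<noteq> {}" using D(2)[of UNIV] by auto
  define q where "q = from_nat_into D"
  have q: "\<exists>i. dist (q i) u < \<epsilon>" if "0 < \<epsilon>" for u \<epsilon>
  proof -
    obtain d where "d \<in> D" "d \<in> ball u \<epsilon>" using D(2)[of "ball u \<epsilon>"] \<open>0 < \<epsilon>\<close> by auto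
    moreover have "range q = D" using D(1) \<open>D \<noteq> {}\<close> by (simp add: q_def range_from_nat_into)
    ultimately show ?thesis by (auto simp: dist_commute)
  qed
  \<comment> \<open>As soon as the sequence coded by \<open>z\<close> is seen not to be fast Cauchy, it is replaced by a
     constant, so that the limit always exists.\<close>
  define s where "s n z = (if \<forall>j\<le>n. \<forall>i\<le>j. dist (q (z i)) (q (z j)) \<le> (1 / 2) ^ i then q (z n) else q 0)"
    for n :: nat and z :: "nat \<Rightarrow> nat"
  have conv: "convergent (\<lambda>n. s n z)" for z
  proof (cases "\<forall>j. \<forall>i\<le>j. dist (q (z i)) (q (z j)) \<le> (1 / 2) ^ i")
    case True
    then have s: "s n z = q (z n)" for n by (simp add: s_def)
    have "Cauchy (\<lambda>n. q (z n))"
    proof (rule metric_CauchyI)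
      fix \<epsilon> :: real assume "0 < \<epsilon>"
      then obtain N where N: "(1 / 2) ^ N < \<epsilon> / 2"
        using real_arch_pow_inv[of "\<epsilon> / 2" "1 / 2"] by auto
      have "dist (q (z m)) (q (z n)) < \<epsilon>" if "N \<le> m" "N \<le> n" for m n
        using True[rule_format, of N m] True[rule_format, of N n] that N
          dist_triangle3[of "q (z m)" "q (z n)" "q (z N)"] by linarith
      then show "\<exists>N. \<forall>m\<ge>N. \<forall>n\<ge>N. dist (q (z m)) (q (z n)) < \<epsilon>" by blast
    qed
    then show ?thesis by (simp add: s Cauchy_convergent_iff)
  next
    case False
    then obtain i j where "i \<le> j" "\<not> dist (q (z i)) (q (z j)) \<le> (1 / 2) ^ i" by auto
    then have "s n z = q 0" if "n \<ge> j" for n using that by (auto simp: s_def)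
    then have "(\<lambda>n. s n z) \<longlonglongrightarrow> q 0"
      by (intro tendsto_eventually eventually_sequentiallyI)
    then show ?thesis by (rule convergentI)
  qed
  show thesis
  proof
    have [measurable]: "q \<in> count_space UNIV \<rightarrow>\<^sub>M borel" by simp
    have [measurable]: "(\<lambda>z. q (z i)) \<in> baire \<rightarrow>\<^sub>M borel" for i by measurable
    have "s n \<in> baire \<rightarrow>\<^sub>M borel" for n
      unfolding s_def by measurable
    then show "(\<lambda>z. lim (\<lambda>n. s n z)) \<in> baire \<rightarrow>\<^sub>M borel"
      by (rule borel_measurable_LIMSEQ_metric) (use conv in \<open>simp add: convergent_LIMSEQ_iff\<close>)
    show "surj (\<lambda>z. lim (\<lambda>n. s n z))"
      unfolding surj_def
    proof
      fix u
      have "\<exists>i. dist (q i) u < (1 / 2) ^ n / 2" for n :: nat by (rule q) simp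
      then obtain z where z: "\<And>n. dist (q (z n)) u < (1 / 2) ^ n / 2" by metis
      have "dist (q (z i)) (q (z j)) \<le> (1 / 2) ^ i" if "i \<le> j" for i j
      proof -
        have "(1 / 2 :: real) ^ j \<le> (1 / 2) ^ i" using that by (intro power_decreasing) auto
        then show ?thesis using dist_triangle2[of "q (z i)" "q (z j)" u] z[of i] z[of j] by linarith
      qed
      then have s: "s n z = q (z n)" for n by (simp add: s_def)
      have "(\<lambda>n. dist (q (z n)) u) \<longlonglongrightarrow> 0"
      proof (rule tendsto_sandwich[OF _ _ tendsto_const])
        show "(\<lambda>n. (1 / 2 :: real) ^ n) \<longlonglongrightarrow> 0" by (rule LIMSEQ_realpow_zero) auto
        show "\<forall>\<^sub>F n in sequentially. dist (q (z n)) u \<le> (1 / 2) ^ n"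
        proof (intro always_eventually allI)
          fix n
          have "(0 :: real) < (1 / 2) ^ n" by simp
          then show "dist (q (z n)) u \<le> (1 / 2) ^ n" using z[of n] by linarith
        qed
      qed simp
      then have "(\<lambda>n. s n z) \<longlonglongrightarrow> u" unfolding s by (rule tendsto_dist_iff[THEN iffD2])
      then show "\<exists>z. u = lim (\<lambda>n. s n z)" by (metis limI)
    qed
  qed
qed

text \<open>A sequence \<open>z\<close> codes two points, \<open>P\<close> says that both lie in
  \<open>X\<close>, and \<open>D z\<close> is their distance. As \<open>P\<close> and
  \<open>D\<close> do not depend on \<open>A\<close>, the complexity of \<open>A\<close> alone
  decides the class obtained for \<open>\<V> A\<close>.\<close>

lemma \<V>_coded:
  obtains P :: "('u::polish_space set \<times> (nat \<Rightarrow> nat)) set" and D :: "(nat \<Rightarrow> nat) \<Rightarrow> real"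
  where "P \<in> sets (effros \<Otimes>\<^sub>M baire)" "D \<in> baire \<rightarrow>\<^sub>M borel" "\<And>z. 0 \<le> D z"
    "\<And>A X. X \<in> nonempty_closed \<Longrightarrow> X \<in> \<V> A \<longleftrightarrow> (\<forall>z. (X, z) \<in> P \<longrightarrow> D z \<in> A)"
proof -
  obtain p :: "(nat \<Rightarrow> nat) \<Rightarrow> 'u" where p [measurable]: "p \<in> baire \<rightarrow>\<^sub>M borel" and surj: "surj p"
    by (rule baire_borel_surjection)
  show thesis
  proof
    let ?M = "(effros :: 'u set measure) \<Otimes>\<^sub>M baire"
    let ?P = "{x \<in> space ?M. p (left (snd x)) \<in> fst x} \<inter> {x \<in> space ?M. p (right (snd x)) \<in> fst x}"
    show "?P \<in> sets ?M"
      by (intro sets.Int sets_mem_effros) measurable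
    show "(\<lambda>z. dist (p (left z)) (p (right z))) \<in> baire \<rightarrow>\<^sub>M borel" by measurable
    fix A and X :: "'u set" assume X: "X \<in> nonempty_closed"
    have "(\<forall>z. (X, z) \<in> ?P \<longrightarrow> dist (p (left z)) (p (right z)) \<in> A) \<longleftrightarrow>
        (\<forall>u\<in>X. \<forall>v\<in>X. dist u v \<in> A)"
    proof (intro iffI ballI)
      fix u v assume *: "\<forall>z. (X, z) \<in> ?P \<longrightarrow> dist (p (left z)) (p (right z)) \<in> A"
        and uv: "u \<in> X" "v \<in> X"
      obtain y z where "u = p y" "v = p z" using surj by (meson surjD)
      with *[rule_format, of "join y z"] uv X show "dist u v \<in> A"
        by (simp add: space_pair_measure)
    qed auto
    then show "X \<in> \<V> A \<longleftrightarrow> (\<forall>z. (X, z) \<in> ?P \<longrightarrow> dist (p (left z)) (p (right z)) \<in> A)"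
      using X by (auto simp: \<V>_def distances_def)
  qed simp
qed

lemma mem_fst_image_iff: "x \<in> fst ` C \<longleftrightarrow> (\<exists>y. (x, y) \<in> C)"
  by force

lemma \<V>_subset_effros: "\<V> A \<subseteq> space effros"
  by (auto simp: \<V>_def)

lemma \<V>_in_pi11:
  assumes [measurable]: "A \<in> sets borel"
  shows "(\<V> A :: 'u::polish_space set set) \<in> pi11 effros"
proof -
  obtain P :: "('u set \<times> (nat \<Rightarrow> nat)) set" and D
    where P [measurable]: "P \<in> sets (effros \<Otimes>\<^sub>M baire)" and D [measurable]: "D \<in> baire \<rightarrow>\<^sub>M borel"
      and V: "\<And>A X. X \<in> nonempty_closed \<Longrightarrow> X \<in> \<V> A \<longleftrightarrow> (\<forall>z. (X, z) \<in> P \<longrightarrow> D z \<in> A)"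
    by (rule \<V>_coded) blast
  let ?C = "P \<inter> {x \<in> space (effros \<Otimes>\<^sub>M baire). D (snd x) \<notin> A}"
  have "?C \<in> sets (effros \<Otimes>\<^sub>M baire)" by measurable
  then have "fst ` ?C \<in> sigma11 effros" unfolding sigma11_def by blast
  moreover have "\<V> A = space effros - fst ` ?C"
    using V[of _ A] \<V>_subset_effros[of A]
    by (auto simp: space_pair_measure mem_fst_image_iff)
  ultimately show ?thesis unfolding pi11_def by blast
qed

text \<open>The implication from \<open>(X, z) \<in> P\<close> to \<open>D z \<in> A\<close> is
  analytic, with the witness for \<open>A\<close> as the last coordinate in \<open>?C\<close>;
  \<open>\<V> A\<close> arises by quantifying universally over \<open>z\<close>.\<close>

lemma \<V>_in_pi12:
  assumes "A \<in> sigma11 (restrict_space borel {0..})"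
  shows "(\<V> A :: 'u::polish_space set set) \<in> pi12 effros"
proof -
  obtain P :: "('u set \<times> (nat \<Rightarrow> nat)) set" and D
    where P [measurable]: "P \<in> sets (effros \<Otimes>\<^sub>M baire)" and D [measurable]: "D \<in> baire \<rightarrow>\<^sub>M borel"
      and D_nonneg: "\<And>z. 0 \<le> D z"
      and V: "\<And>A X. X \<in> nonempty_closed \<Longrightarrow> X \<in> \<V> A \<longleftrightarrow> (\<forall>z. (X, z) \<in> P \<longrightarrow> D z \<in> A)"
    by (rule \<V>_coded) blast
  obtain E where E [measurable]: "E \<in> sets (restrict_space borel {0..} \<Otimes>\<^sub>M baire)" and A: "A = fst ` E"
    using assms unfolding sigma11_def by blast
  have D': "D \<in> baire \<rightarrow>\<^sub>M restrict_space borel {0..}"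
    using D D_nonneg by (auto intro: measurable_restrict_space2)
  let ?M = "(effros :: 'u set measure) \<Otimes>\<^sub>M baire"
  define g where "g x = (D (snd (fst x)), snd x)" for x :: "('u set \<times> (nat \<Rightarrow> nat)) \<times> (nat \<Rightarrow> nat)"
  have g: "g \<in> ?M \<Otimes>\<^sub>M baire \<rightarrow>\<^sub>M restrict_space borel {0..} \<Otimes>\<^sub>M baire"
    unfolding g_def by (intro measurable_Pair measurable_compose[OF _ D']) measurable
  let ?C = "{x \<in> space (?M \<Otimes>\<^sub>M baire). fst x \<notin> P} \<union> (g -` E \<inter> space (?M \<Otimes>\<^sub>M baire))"
  define S where "S = fst ` (space ?M - fst ` ?C)"
  have "?C \<in> sets (?M \<Otimes>\<^sub>M baire)"
    using measurable_sets[OF g E] by measurable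
  then have "fst ` ?C \<in> sigma11 ?M" unfolding sigma11_def by blast
  then have "S \<in> sigma12 effros"
    unfolding sigma12_def pi11_def S_def by blast
  moreover have "\<V> A = space effros - S"
  proof -
    have "(X, z) \<in> fst ` ?C \<longleftrightarrow> (X, z) \<notin> P \<or> D z \<in> A" if "X \<in> nonempty_closed" for X z
      using that by (auto simp: A g_def space_pair_measure mem_fst_image_iff)
    then have "X \<in> S \<longleftrightarrow> (\<exists>z. (X, z) \<in> P \<and> D z \<notin> A)"
      if "X \<in> nonempty_closed" for X
      unfolding S_def mem_fst_image_iff[of X] using that by (auto simp: space_pair_measure)
    then show ?thesis using V[of _ A] \<V>_subset_effros[of A] by auto
  qed
  ultimately show ?thesis unfolding pi12_def by blast
qed

text \<open>A distance outside a closed \<open>A\<close> persists on a product of two basic open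
  sets, so \<open>X\<close> is in \<open>\<V> A\<close> iff it misses a member of each of countably
  many pairs.\<close>

lemma \<V>_closed_borel:
  assumes A: "closed A"
  shows "(\<V> A :: 'u::polish_space set set) \<in> sets effros"
proof -
  obtain B :: "'u set set" where B: "countable B" "topological_basis B"
    using ex_countable_basis by auto
  define I where "I = {(W1, W2). W1 \<in> B \<and> W2 \<in> B \<and> (\<forall>x\<in>W1. \<forall>y\<in>W2. dist x y \<notin> A)}"
  have "countable I"
    by (rule countable_subset[of _ "B \<times> B"]) (auto simp: I_def B(1))
  have open_B: "open W" if "W \<in> B" for W using that B(2) by (rule topological_basis_open[rotated])
  let ?meets = "\<lambda>W. {X \<in> nonempty_closed. X \<inter> W \<noteq> {}} :: 'u set set"
  have "\<V> A = space effros - (\<Union>(W1, W2)\<in>I. ?meets W1 \<inter> ?meets W2)"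
  proof (intro equalityI subsetI)
    fix X :: "'u set" assume "X \<in> \<V> A"
    then show "X \<in> space effros - (\<Union>(W1, W2)\<in>I. ?meets W1 \<inter> ?meets W2)"
      by (fastforce simp: \<V>_def distances_def I_def)
  next
    fix X :: "'u set" assume X: "X \<in> space effros - (\<Union>(W1, W2)\<in>I. ?meets W1 \<inter> ?meets W2)"
    have "dist x y \<in> A" if xy: "x \<in> X" "y \<in> X" for x y
    proof (rule ccontr)
      assume "dist x y \<notin> A"
      then have "(x, y) \<in> (\<lambda>p. dist (fst p) (snd p)) -` (- A)" by simp
      moreover have "open ((\<lambda>p :: 'u \<times> 'u. dist (fst p) (snd p)) -` (- A))"
        using A by (intro open_vimage continuous_intros) auto
      ultimately obtain S1 S2 where S: "open S1" "open S2" "(x, y) \<in> S1 \<times> S2"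
          "S1 \<times> S2 \<subseteq> (\<lambda>p. dist (fst p) (snd p)) -` (- A)"
        using open_prod_elim by blast
      obtain W1 where W1: "W1 \<in> B" "x \<in> W1" "W1 \<subseteq> S1"
        using topological_basisE[OF B(2) S(1), of x] S(3) by blast
      obtain W2 where W2: "W2 \<in> B" "y \<in> W2" "W2 \<subseteq> S2"
        using topological_basisE[OF B(2) S(2), of y] S(3) by blast
      from W1 W2 S(4) have "(W1, W2) \<in> I" by (fastforce simp: I_def)
      then show False using X xy W1 W2 by auto
    qed
    with X show "X \<in> \<V> A" by (auto simp: \<V>_def distances_def)
  qed
  also have "\<dots> \<in> sets effros"
    using open_B by (intro sets.Diff sets.top sets.countable_UN'' \<open>countable I\<close>)
      (auto simp: I_def intro!: sets.Int sets_effros_meets)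
  finally show ?thesis .
qed

text \<open>
  If \<open>0\<close> is isolated in \<open>A\<close>, the members of \<open>\<V> A\<close> are uniformly discrete, so their points are Borel
  functions of the space, picked out by small balls.
\<close>

lemma \<V>_isolated_borel:
  assumes A: "A \<in> sets borel" "A \<subseteq> {0..}" "0 \<in> A" and isolated: "\<not> 0 islimpt A"
  shows "(\<V> A :: 'u::polish_space set set) \<in> sets effros"
proof -
  obtain \<epsilon> where \<epsilon>: "0 < \<epsilon>" "\<And>r. r \<in> A \<Longrightarrow> r \<noteq> 0 \<Longrightarrow> \<epsilon> \<le> r"
  proof -
    obtain \<epsilon> where "0 < \<epsilon>" "\<forall>r\<in>A. r \<noteq> 0 \<longrightarrow> \<epsilon> \<le> dist r 0"
      using isolated unfolding islimpt_approachable by (auto simp: not_less)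
    moreover from this A(2) have "\<epsilon> \<le> r" if "r \<in> A" "r \<noteq> 0" for r
      using that by (fastforce simp: dist_real_def)
    ultimately show thesis using that by blast
  qed
  \<comment> \<open>A closed set of distances containing \<open>A\<close>: \<open>\<V> E\<close> is
    Borel and its members have points at least \<open>\<epsilon>\<close> apart.\<close>
  define E where "E = insert 0 {\<epsilon>..}"
  have "closed E" by (simp add: E_def)
  have "A \<subseteq> E" using \<epsilon>(2) by (auto simp: E_def)
  obtain D :: "'u set" where D: "countable D" "\<And>W. open W \<Longrightarrow> W \<noteq> {} \<Longrightarrow> \<exists>d\<in>D. d \<in> W"
    by (rule countable_dense_setE) blast
  have D_ball: "\<exists>d\<in>D. x \<in> ball d (\<epsilon> / 2)" for x
  proof -
    obtain d where "d \<in> D" "d \<in> ball x (\<epsilon> / 2)" using D(2)[of "ball x (\<epsilon> / 2)"] \<epsilon>(1) by auto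
    then show ?thesis by (auto simp: dist_commute)
  qed
  \<comment> \<open>The choice is meaningful on \<open>\<Omega> d\<close>, where the ball of radius
    \<open>\<epsilon> / 2\<close> contains exactly one point of \<open>X\<close>.\<close>
  define pt where "pt d X = (SOME x. x \<in> X \<inter> ball d (\<epsilon> / 2))" for d and X :: "'u set"
  define \<Omega> where "\<Omega> d = \<V> E \<inter> {X \<in> nonempty_closed. X \<inter> ball d (\<epsilon> / 2) \<noteq> {}}" for d :: 'u
  have \<Omega>_sets: "\<Omega> d \<in> sets effros" for d
    unfolding \<Omega>_def by (intro sets.Int \<V>_closed_borel \<open>closed E\<close> sets_effros_meets) simp
  have pt: "X \<inter> ball d (\<epsilon> / 2) = {pt d X}" if "X \<in> \<Omega> d" for d X
  proof -
    have "pt d X \<in> X \<inter> ball d (\<epsilon> / 2)"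
      unfolding pt_def by (rule someI_ex) (use that in \<open>auto simp: \<Omega>_def\<close>)
    moreover have "x = y" if xy: "x \<in> X \<inter> ball d (\<epsilon> / 2)" "y \<in> X \<inter> ball d (\<epsilon> / 2)" for x y
    proof -
      have "dist x y < \<epsilon>" using xy dist_triangle3[of x y d] by auto
      moreover have "dist x y \<in> E" using \<open>X \<in> \<Omega> d\<close> xy by (auto simp: \<Omega>_def \<V>_def distances_def)
      ultimately show ?thesis by (auto simp: E_def)
    qed
    ultimately show ?thesis by blast
  qed
  have pt_measurable: "pt d \<in> restrict_space effros (\<Omega> d) \<rightarrow>\<^sub>M borel" for d
  proof (rule borel_measurableI)
    fix W :: "'u set" assume "open W"
    then have "{X \<in> nonempty_closed. X \<inter> (ball d (\<epsilon> / 2) \<inter> W) \<noteq> {}} \<in> sets effros"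
      by (intro sets_effros_meets) auto
    moreover have "pt d -` W \<inter> space (restrict_space effros (\<Omega> d)) =
        {X \<in> nonempty_closed. X \<inter> (ball d (\<epsilon> / 2) \<inter> W) \<noteq> {}} \<inter> \<Omega> d"
    proof -
      have "pt d X \<in> W \<longleftrightarrow> X \<inter> (ball d (\<epsilon> / 2) \<inter> W) \<noteq> {}" if "X \<in> \<Omega> d" for X
        by (simp add: Int_assoc[symmetric] pt[OF that])
      moreover have "\<Omega> d \<subseteq> nonempty_closed" by (auto simp: \<Omega>_def)
      ultimately show ?thesis by (auto simp: space_restrict_space)
    qed
    ultimately show "pt d -` W \<inter> space (restrict_space effros (\<Omega> d)) \<in> sets (restrict_space effros (\<Omega> d))"
      by (auto simp: sets_restrict_space)
  qed
  \<comment> \<open>The spaces in which the points picked by the two balls are at a distance outside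
    \<open>A\<close>. Centres from a countable dense set reach all pairs of points.\<close>
  define G where "G d d' = {X \<in> \<Omega> d \<inter> \<Omega> d'. dist (pt d X) (pt d' X) \<notin> A}" for d d'
  have G_sets: "G d d' \<in> sets effros" for d d'
  proof -
    let ?R = "restrict_space effros (\<Omega> d \<inter> \<Omega> d') :: 'u set measure"
    have [measurable]: "pt d \<in> ?R \<rightarrow>\<^sub>M borel" "pt d' \<in> ?R \<rightarrow>\<^sub>M borel"
      using pt_measurable[of d] pt_measurable[of d']
      by (auto intro: measurable_restrict_mono)
    note A(1) [measurable]
    have "{X \<in> space ?R. dist (pt d X) (pt d' X) \<notin> A} \<in> sets ?R" by measurable
    moreover have \<Omega>\<Omega>: "\<Omega> d \<inter> \<Omega> d' \<in> sets effros" by (intro sets.Int \<Omega>_sets)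
    moreover have "space ?R = \<Omega> d \<inter> \<Omega> d'"
      using sets.sets_into_space[OF \<Omega>\<Omega>] by (auto simp: space_restrict_space)
    ultimately show ?thesis
      using sets_restrict_space_iff[OF sets.Int[OF \<Omega>\<Omega> sets.top], of "G d d'"] unfolding G_def by simp
  qed
  have "\<V> A = \<V> E - (\<Union>d\<in>D. \<Union>d'\<in>D. G d d')"
  proof (intro equalityI subsetI)
    fix X :: "'u set" assume X: "X \<in> \<V> A"
    have "X \<notin> G d d'" for d d'
    proof
      assume "X \<in> G d d'"
      then have "pt d X \<in> X" "pt d' X \<in> X" "dist (pt d X) (pt d' X) \<notin> A"
        using pt[of X d] pt[of X d'] by (auto simp: G_def)
      then show False using X by (auto simp: \<V>_def distances_def)
    qed
    moreover have "X \<in> \<V> E" using X \<open>A \<subseteq> E\<close> by (auto simp: \<V>_def)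
    ultimately show "X \<in> \<V> E - (\<Union>d\<in>D. \<Union>d'\<in>D. G d d')" by simp
  next
    fix X :: "'u set" assume X: "X \<in> \<V> E - (\<Union>d\<in>D. \<Union>d'\<in>D. G d d')"
    have "dist x y \<in> A" if xy: "x \<in> X" "y \<in> X" for x y
    proof -
      obtain d d' where d: "d \<in> D" "x \<in> ball d (\<epsilon> / 2)" "d' \<in> D" "y \<in> ball d' (\<epsilon> / 2)"
        using D_ball by meson
      then have "X \<in> \<Omega> d" "X \<in> \<Omega> d'" using X xy by (auto simp: \<Omega>_def \<V>_def)
      moreover from pt[OF this(1)] pt[OF this(2)] have "x = pt d X" "y = pt d' X" using d xy by auto
      ultimately show ?thesis using X d by (auto simp: G_def)
    qed
    with X show "X \<in> \<V> A" by (auto simp: \<V>_def distances_def)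
  qed
  also have "\<dots> \<in> sets effros"
    by (intro sets.Diff \<V>_closed_borel \<open>closed E\<close> sets.countable_UN'' D(1) G_sets)
  finally show ?thesis .
qed

section \<open>Lower bounds for the complexity of \<open>\<V> A\<close>\<close>

lemma \<V>_borel_imp_borel:
  assumes U: "universal_metric TYPE('u::polish_space)"
    and A: "A \<subseteq> {0..}" "0 \<in> A" and V: "(\<V> A :: 'u set set) \<in> sets effros"
  shows "A \<in> sets borel"
proof -
  obtain S :: "real set" where "countable S" "closure S = UNIV"
    using separable[of "UNIV :: real set"] by (metis subset_UNIV subset_antisym)
  then have sep: "\<exists>S. countable S \<and> S \<subseteq> UNIV \<and> Met_TC.mtopology closure_of S = (UNIV :: real set)"
    by (intro exI[of _ S]) (simp add: mtopology_is_euclidean)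
  obtain p :: "real \<Rightarrow> 'u" where "\<forall>r\<in>UNIV. \<forall>s\<in>UNIV. dist (p r) (p s) = dist r s"
    using U[unfolded universal_metric_def, rule_format, OF conjI, OF Met_TC.Metric_space_axioms sep] ..
  then have p: "dist (p r) (p s) = dist r s" for r s by simp
  have p_cont: "continuous_on UNIV p"
    unfolding continuous_on_iff by (metis p)
  \<comment> \<open>Two-point subsets of an isometric copy of the real line: \<open>f r\<close> has
    the distances 0 and \<open>\<bar>r\<bar>\<close>, so \<open>f\<close> pulls
    \<open>\<V> A\<close> back to \<open>A\<close> on the nonnegative reals.\<close>
  define f where "f r = {p 0, p r}" for r
  have "f \<in> borel \<rightarrow>\<^sub>M effros"
  proof (rule measurable_effrosI)
    show "f r \<in> nonempty_closed" for r by (simp add: f_def nonempty_closed_def)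
    fix W :: "'u set" assume "open W"
    then have "open (p -` W)" using p_cont open_vimage by blast
    moreover have "{r \<in> space borel. f r \<inter> W \<noteq> {}} = (if p 0 \<in> W then UNIV else p -` W)"
      by (auto simp: f_def)
    ultimately show "{r \<in> space borel. f r \<inter> W \<noteq> {}} \<in> sets borel" by simp
  qed
  from measurable_sets[OF this V] have "f -` \<V> A \<in> sets borel" by simp
  moreover have "A = {0..} \<inter> f -` \<V> A"
  proof -
    have "distances (f r) = {0, \<bar>r\<bar>}" for r
      unfolding distances_def f_def by (auto simp: p dist_real_def) (metis p dist_real_def diff_0 abs_minus_cancel)
    then have "f r \<in> \<V> A \<longleftrightarrow> \<bar>r\<bar> \<in> A" for r
      using A(2) by (simp add: \<V>_def f_def nonempty_closed_def)
    then show ?thesis using A(1) by auto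
  qed
  ultimately show ?thesis by (metis atLeast_borel sets.Int)
qed

text \<open>The limit \<open>v\<close> is held at a fixed \<open>r \<in> closure A - A\<close>, so
  \<open>f x\<close> leaves \<open>\<V> A\<close> as soon as the section of \<open>C\<close> at
  \<open>x\<close> is nonempty.\<close>

lemma \<V>_pi11_hard:
  assumes U: "universal_metric TYPE('u::polish_space)"
    and A: "A \<subseteq> {0..}" "0 \<in> A" "0 islimpt A" "\<not> closed A"
  shows "gamma_hard (pi11 :: 'x measure \<Rightarrow> 'x set set) effros (\<V> A :: 'u set set)"
  unfolding gamma_hard_def
proof (intro allI impI ballI)
  fix X :: "'x measure" and B assume "B \<in> pi11 X"
  then obtain C where C [measurable]: "C \<in> sets (X \<Otimes>\<^sub>M baire)" and B: "B = space X - fst ` C"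
    unfolding pi11_def sigma11_def by blast
  obtain r where r: "r \<in> closure A" "r \<notin> A"
    using A(4) closure_subset[of A] closed_closure[of A] by (metis subsetI subset_antisym)
  let ?M = "X \<Otimes>\<^sub>M ((borel :: real measure) \<Otimes>\<^sub>M baire)"
  let ?C = "{x \<in> space ?M. fst (snd x) = r \<and> (fst x, snd (snd x)) \<in> C}"
  have "?C \<in> sets ?M" by measurable
  then obtain f where f: "f \<in> X \<rightarrow>\<^sub>M (effros :: 'u set measure)"
    "\<And>x. x \<in> space X \<Longrightarrow> f x \<in> \<V> A \<longleftrightarrow> (\<forall>v y. v \<in> closure A \<longrightarrow> (x, v, y) \<in> ?C \<longrightarrow> v \<in> A)"
    by (rule effros_reduction[OF U A(1-3)]) blast
  have "f x \<in> \<V> A \<longleftrightarrow> x \<notin> fst ` C" if "x \<in> space X" for x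
    unfolding f(2)[OF that] mem_fst_image_iff using that r by (auto simp: space_pair_measure)
  then have "f -` \<V> A \<inter> space X = B" unfolding B by blast
  with f(1) show "\<exists>f\<in>X \<rightarrow>\<^sub>M effros. f -` (\<V> A :: 'u set set) \<inter> space X = B" by blast
qed

text \<open>Taking for \<open>C\<close> the graph of a Borel reduction \<open>g\<close> of
  \<open>S\<close> to \<open>A\<close>, membership in \<open>\<V> A\<close> says that
  \<open>g (x, y) \<in> A\<close> for all \<open>y\<close>, that is \<open>(x, y) \<in> S\<close>
  for all \<open>y\<close>.\<close>

lemma \<V>_pi12_hard:
  assumes U: "universal_metric TYPE('u::polish_space)"
    and A: "A \<subseteq> {0..}" "0 \<in> A" "0 islimpt A" "\<not> closed A"
    and h: "h \<in> baire \<rightarrow>\<^sub>M borel" "h -` A = souslin_codes"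
  shows "gamma_hard (pi12 :: 'x measure \<Rightarrow> 'x set set) effros (\<V> A :: 'u set set)"
  unfolding gamma_hard_def
proof (intro allI impI ballI)
  fix X :: "'x measure" and B assume "B \<in> pi12 X"
  then obtain S where S: "S \<in> sigma11 (X \<Otimes>\<^sub>M baire)"
    and B: "B = space X - fst ` (space (X \<Otimes>\<^sub>M baire) - S)"
    unfolding pi12_def sigma12_def pi11_def by blast
  obtain i where i [measurable]: "i \<in> X \<Otimes>\<^sub>M baire \<rightarrow>\<^sub>M baire"
    and i_iff: "\<And>p. p \<in> space (X \<Otimes>\<^sub>M baire) \<Longrightarrow> p \<in> S \<longleftrightarrow> i p \<in> souslin_codes"
    using sigma11_reduces_souslin_codes[OF S] by blast
  obtain r where r: "r \<in> closure A" "r \<notin> A"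
    using A(4) closure_subset[of A] closed_closure[of A] by (metis subsetI subset_antisym)
  have [measurable]: "closure A \<in> sets borel" by simp
  note h(1) [measurable]
  \<comment> \<open>\<open>effros_reduction\<close> tests only values in \<open>closure A\<close>;
    values outside it are moved to \<open>r\<close>, which is in \<open>closure A\<close> but still
    not in \<open>A\<close>.\<close>
  define g where "g p = (if h (i p) \<in> closure A then h (i p) else r)" for p
  have [measurable]: "g \<in> X \<Otimes>\<^sub>M baire \<rightarrow>\<^sub>M borel" unfolding g_def by measurable
  have g: "g p \<in> closure A" "p \<in> space (X \<Otimes>\<^sub>M baire) \<Longrightarrow> g p \<in> A \<longleftrightarrow> p \<in> S" for p
    using r h(2) closure_subset[of A] by (auto simp: g_def i_iff)
  let ?M = "X \<Otimes>\<^sub>M ((borel :: real measure) \<Otimes>\<^sub>M baire)"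
  let ?C = "{x \<in> space ?M. fst (snd x) = g (fst x, snd (snd x))}"
  have "?C \<in> sets ?M" by measurable
  then obtain f where f: "f \<in> X \<rightarrow>\<^sub>M (effros :: 'u set measure)"
    "\<And>x. x \<in> space X \<Longrightarrow> f x \<in> \<V> A \<longleftrightarrow> (\<forall>v y. v \<in> closure A \<longrightarrow> (x, v, y) \<in> ?C \<longrightarrow> v \<in> A)"
    by (rule effros_reduction[OF U A(1-3)]) blast
  have "f x \<in> \<V> A \<longleftrightarrow> x \<in> B" if x: "x \<in> space X" for x
  proof -
    have "f x \<in> \<V> A \<longleftrightarrow> (\<forall>y. g (x, y) \<in> A)"
      unfolding f(2)[OF x] using x g(1) by (auto simp: space_pair_measure)
    also have "\<dots> \<longleftrightarrow> (\<forall>y. (x, y) \<in> S)" using x g(2) by (simp add: space_pair_measure)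
    also have "\<dots> \<longleftrightarrow> x \<in> B"
      using x by (simp add: B mem_fst_image_iff space_pair_measure)
    finally show ?thesis .
  qed
  then have "f -` \<V> A \<inter> space X = B" unfolding B by blast
  with f(1) show "\<exists>f\<in>X \<rightarrow>\<^sub>M effros. f -` (\<V> A :: 'u set set) \<inter> space X = B" by blast
qed

theorem theorem4p5:
  fixes A :: "real set"
  assumes "urysohn_space TYPE('u::polish_space)"
    and "A \<subseteq> {0..}" and "0 \<in> A"
  shows "(\<not> closed A \<and> 0 islimpt A \<longrightarrow>
            gamma_hard (pi11 :: 'x measure \<Rightarrow> 'x set set) effros (\<V> A :: 'u set set))
       \<and> ((\<V> A :: 'u set set) \<in> sets effros \<longleftrightarrow>
            closed A \<or> (A \<in> sets borel \<and> \<not> 0 islimpt A))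
       \<and> (A \<in> sets borel \<and> \<not> closed A \<and> 0 islimpt A \<longrightarrow>
            gamma_complete (pi11 :: 'x measure \<Rightarrow> 'x set set) pi11 effros (\<V> A :: 'u set set))
       \<and> (gamma_complete (sigma11 :: (nat \<Rightarrow> nat) measure \<Rightarrow> (nat \<Rightarrow> nat) set set) sigma11
              (restrict_space borel {0..}) A \<and> 0 islimpt A \<longrightarrow>
            gamma_complete (pi12 :: 'x measure \<Rightarrow> 'x set set) pi12 effros (\<V> A :: 'u set set))"
proof (intro conjI impI)
  have U: "universal_metric TYPE('u)" using assms(1) by (simp add: urysohn_space_def)
  note A = assms(2,3)
  have codes_pi11: "UNIV - souslin_codes \<in> pi11 baire"
    using souslin_codes_sigma11 unfolding pi11_def by auto
  show "gamma_hard (pi11 :: 'x measure \<Rightarrow> 'x set set) effros (\<V> A :: 'u set set)"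
    if "\<not> closed A \<and> 0 islimpt A"
    using \<V>_pi11_hard[OF U A] that by blast
  show "(\<V> A :: 'u set set) \<in> sets effros \<longleftrightarrow> closed A \<or> (A \<in> sets borel \<and> \<not> 0 islimpt A)"
  proof
    assume V: "(\<V> A :: 'u set set) \<in> sets effros"
    have False if "\<not> closed A" "0 islimpt A"
    proof -
      \<comment> \<open>Hardness is taken with the Baire space as test space: a Borel
        \<open>\<V> A\<close> would make \<open>UNIV - souslin_codes\<close> Borel.\<close>
      have "gamma_hard (pi11 :: (nat \<Rightarrow> nat) measure \<Rightarrow> _) effros (\<V> A :: 'u set set)"
        by (rule \<V>_pi11_hard[OF U A that(2,1)])
      then obtain f where "f \<in> baire \<rightarrow>\<^sub>M (effros :: 'u set measure)"
        "f -` \<V> A \<inter> space baire = UNIV - souslin_codes"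
        using standard_borel_baire codes_pi11 unfolding gamma_hard_def by blast
      with V have "UNIV - souslin_codes \<in> sets borel" by (metis measurable_sets)
      from sets.compl_sets[OF this] have "souslin_codes \<in> sets borel" by (simp add: double_diff)
      then show False using souslin_codes_not_borel by simp
    qed
    then show "closed A \<or> (A \<in> sets borel \<and> \<not> 0 islimpt A)"
      using \<V>_borel_imp_borel[OF U A V] by blast
  qed (use \<V>_closed_borel \<V>_isolated_borel A in blast)
  show "gamma_complete (pi11 :: 'x measure \<Rightarrow> 'x set set) pi11 effros (\<V> A :: 'u set set)"
    if "A \<in> sets borel \<and> \<not> closed A \<and> 0 islimpt A"
    using \<V>_in_pi11 \<V>_pi11_hard[OF U A] that unfolding gamma_complete_def by blast
  assume *: "gamma_complete (sigma11 :: (nat \<Rightarrow> nat) measure \<Rightarrow> (nat \<Rightarrow> nat) set set) sigma11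
              (restrict_space borel {0..}) A \<and> 0 islimpt A"
  then obtain h where h: "h \<in> baire \<rightarrow>\<^sub>M restrict_space borel {0..}" "h -` A \<inter> space baire = souslin_codes"
    using standard_borel_baire souslin_codes_sigma11 unfolding gamma_complete_def gamma_hard_def
    by blast
  have h': "h \<in> baire \<rightarrow>\<^sub>M borel" "h -` A = souslin_codes"
    using h by (auto simp: measurable_restrict_space2_iff)
  \<comment> \<open>A closed \<open>A\<close> would be Borel, and then so would its preimage
    \<open>souslin_codes\<close> under \<open>h\<close>.\<close>
  have "\<not> closed A"
  proof
    assume "closed A"
    then have "A \<in> sets borel" by simp
    from measurable_sets[OF h'(1) this] show False
      using h'(2) souslin_codes_not_borel by simp
  qed
  then show "gamma_complete (pi12 :: 'x measure \<Rightarrow> 'x set set) pi12 effros (\<V> A :: 'u set set)"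
    using * \<V>_in_pi12[of A] \<V>_pi12_hard[OF U A _ _ h'] unfolding gamma_complete_def by blast
qed

end
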